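(* Let $d\in\mathbb{N}$, $p=(p_1,\dots,p_d)\in\mathbb{N}^d$, and suppose $V:\mathbb{Z}^d\to\mathbb{R}$ is $p$-periodic and non-degenerate. Put $p_0:=\min\{p_i:i=1,2,\dots,d\}$ and, for $\mu>0$, let $H_\mu=\Delta+\mu V$ on $\ell^2(\mathbb{Z}^d)$. (Upper bound.) For any $\rho_0>0$ there are constants $C,C_1,\mu_0>0$ depending on $d$, $p$, $\operatorname{sep}V$, and $\rho_0$ such that for all $n,m\in\mathbb{Z}^d$, all $\mu\ge\mu_0$, and all $t\ge0$, $$|\langle\delta_n,e^{-\mathrm{i}tH_\mu}\delta_m\rangle|\le C\,e^{-\rho_0\left(|n-m|_1-C_1\mu^{-p_0+1}|t|\right)}.$$ (Optimality.) There is a constant $c>0$ such that the following holds: if for all sufficiently large $\mu$ there are constants $K,\rho,v_{\mathrm{LR}}>0$ (possibly depending on $\mu$) such that $$|\langle\delta_n,e^{-\mathrm{i}tH_\mu}\delta_m\rangle|\le K\,e^{-\rho\left(|n-m|_1-v_{\mathrm{LR}}|t|\right)}\quad\text{for all } n,m\in\mathbb{Z}^d,\ t\ge0,$$ then $v_{\mathrm{LR}}\ge c\,\mu^{-p_0+1}$ for all sufficiently large $\mu$.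
   Context: $\mathbb{N}=\{1,2,\dots\}$. The operator $\Delta$ on $\ell^2(\mathbb{Z}^d)$ is $[\Delta\psi](n)=\sum_{|n-m|_1=1}\psi(m)$ and $V$ acts by multiplication. The function $V$ is $p$-periodic if $V(n+m)=V(n)$ for all $n\in\mathbb{Z}^d$ and $m\in p_1\mathbb{Z}\oplus\cdots\oplus p_d\mathbb{Z}$. With $[\ell]=\{0,1,\dots,\ell-1\}$, the fundamental cell is $W=[p_1]\times\cdots\times[p_d]$, and a $p$-periodic $V$ is non-degenerate if $V$ is injective on $W$. The separation of $V$ is $\operatorname{sep}V=\min\{|V(n)-V(m)|:n,m\in W,\ n\ne m\}$ (understood as $+\infty$ if $W$ is a single point). $\{\delta_n:n\in\mathbb{Z}^d\}$ is the canonical basis of $\ell^2(\mathbb{Z}^d)$, and $|\cdot|_1$ is the $\ell^1$ norm on $\mathbb{Z}^d$. *)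

theory Defs
  imports "HOL-Analysis.Analysis"
begin

section \<open>The Hilbert space of square-summable functions\<close>

typedef 'a ell2 = "{\<psi> :: 'a \<Rightarrow> complex. (\<lambda>n. (cmod (\<psi> n))\<^sup>2) summable_on UNIV}"
  morphisms ell2_apply Abs_ell2
  by (rule exI[of _ "\<lambda>_. 0"]) simp

setup_lifting type_definition_ell2

lemma ell2_summable: "(\<lambda>n. (cmod (ell2_apply \<psi> n))\<^sup>2) summable_on A"
  using ell2_apply[of \<psi>] by (auto intro: summable_on_subset_banach)

lemma ell2_eqI: "(\<And>n. ell2_apply \<psi> n = ell2_apply \<phi> n) \<Longrightarrow> \<psi> = \<phi>"
  by (simp add: ell2_apply_inject[symmetric] ext)

lemma square_summable_comparison:
  fixes f :: "'a \<Rightarrow> real" and g :: "'a \<Rightarrow> complex"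
  assumes "f summable_on A" "\<And>n. n \<in> A \<Longrightarrow> (cmod (g n))\<^sup>2 \<le> f n"
  shows "(\<lambda>n. (cmod (g n))\<^sup>2) summable_on A"
  by (rule summable_on_comparison_test[OF assms(1)]) (use assms(2) in auto)

lemma square_summable_add:
  fixes f g :: "'a \<Rightarrow> complex"
  assumes "(\<lambda>n. (cmod (f n))\<^sup>2) summable_on A" "(\<lambda>n. (cmod (g n))\<^sup>2) summable_on A"
  shows "(\<lambda>n. (cmod (f n + g n))\<^sup>2) summable_on A"
proof (rule square_summable_comparison)
  show "(\<lambda>n. 2 * (cmod (f n))\<^sup>2 + 2 * (cmod (g n))\<^sup>2) summable_on A"
    by (intro summable_on_add summable_on_cmult_right assms)
  fix n
  have "(cmod (f n + g n))\<^sup>2 \<le> (cmod (f n) + cmod (g n))\<^sup>2"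
    by (intro power_mono norm_triangle_ineq) auto
  also have "\<dots> \<le> 2 * (cmod (f n))\<^sup>2 + 2 * (cmod (g n))\<^sup>2"
    using zero_le_power2[of "cmod (f n) - cmod (g n)"]
    by (simp add: power2_sum power2_diff)
  finally show "(cmod (f n + g n))\<^sup>2 \<le> 2 * (cmod (f n))\<^sup>2 + 2 * (cmod (g n))\<^sup>2" .
qed

lemma square_summable_bounded_mult:
  fixes f g :: "'a \<Rightarrow> complex"
  assumes "(\<lambda>n. (cmod (f n))\<^sup>2) summable_on A" "\<And>n. n \<in> A \<Longrightarrow> cmod (g n) \<le> B"
  shows "(\<lambda>n. (cmod (g n * f n))\<^sup>2) summable_on A"
proof (rule square_summable_comparison)
  show "(\<lambda>n. B\<^sup>2 * (cmod (f n))\<^sup>2) summable_on A"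
    by (intro summable_on_cmult_right assms)
  fix n assume "n \<in> A"
  then show "(cmod (g n * f n))\<^sup>2 \<le> B\<^sup>2 * (cmod (f n))\<^sup>2"
    using assms(2) by (auto simp: norm_mult power_mult_distrib intro!: mult_right_mono power_mono)
qed

lemma square_summable_sum:
  fixes f :: "'b \<Rightarrow> 'a \<Rightarrow> complex"
  assumes "finite S" "\<And>s. s \<in> S \<Longrightarrow> (\<lambda>n. (cmod (f s n))\<^sup>2) summable_on A"
  shows "(\<lambda>n. (cmod (\<Sum>s\<in>S. f s n))\<^sup>2) summable_on A"
  using assms by (induction S rule: finite_induct) (auto intro!: square_summable_add)

lift_definition delta :: "'a \<Rightarrow> 'a ell2" is "\<lambda>n m. if m = n then 1 else 0"
proof -
  fix n :: 'a
  have "(\<lambda>m. (cmod (if m = n then 1 else 0))\<^sup>2) summable_on {n}"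
    by simp
  then show "(\<lambda>m. (cmod (if m = n then 1 else 0))\<^sup>2) summable_on UNIV"
    by (rule summable_on_cong_neutral[THEN iffD1, rotated -1]) auto
qed

lift_definition scaleC_ell2 :: "complex \<Rightarrow> 'a ell2 \<Rightarrow> 'a ell2" (infixr "*\<^sub>C" 75)
  is "\<lambda>c \<psi> n. c * \<psi> n"
  by (auto intro: square_summable_bounded_mult)

text \<open>Conjugate-linear in the first argument.\<close>

definition cinner_ell2 :: "'a ell2 \<Rightarrow> 'a ell2 \<Rightarrow> complex" where
  "cinner_ell2 \<psi> \<phi> = (\<Sum>\<^sub>\<infinity>n. cnj (ell2_apply \<psi> n) * ell2_apply \<phi> n)"

lemma cinner_ell2_summable:
  "(\<lambda>n. cnj (ell2_apply \<psi> n) * ell2_apply \<phi> n) summable_on A"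
proof (rule abs_summable_summable, rule summable_on_comparison_test)
  show "(\<lambda>n. (cmod (ell2_apply \<psi> n))\<^sup>2 + (cmod (ell2_apply \<phi> n))\<^sup>2) summable_on A"
    by (intro summable_on_add ell2_summable)
  fix n
  let ?a = "cmod (ell2_apply \<psi> n)" and ?b = "cmod (ell2_apply \<phi> n)"
  have "2 * (?a * ?b) \<le> ?a\<^sup>2 + ?b\<^sup>2" "0 \<le> ?a * ?b"
    using zero_le_power2[of "?a - ?b"] by (auto simp: power2_diff)
  then have "?a * ?b \<le> ?a\<^sup>2 + ?b\<^sup>2" by linarith
  then show "norm (cnj (ell2_apply \<psi> n) * ell2_apply \<phi> n) \<le> ?a\<^sup>2 + ?b\<^sup>2"
    by (simp add: norm_mult)
qed auto

instantiation ell2 :: (type) real_inner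
begin

lift_definition zero_ell2 :: "'a ell2" is "\<lambda>_. 0" by simp
lift_definition plus_ell2 :: "'a ell2 \<Rightarrow> 'a ell2 \<Rightarrow> 'a ell2" is "\<lambda>\<psi> \<phi> n. \<psi> n + \<phi> n"
  by (auto intro: square_summable_add)
lift_definition uminus_ell2 :: "'a ell2 \<Rightarrow> 'a ell2" is "\<lambda>\<psi> n. - \<psi> n" by simp
lift_definition minus_ell2 :: "'a ell2 \<Rightarrow> 'a ell2 \<Rightarrow> 'a ell2" is "\<lambda>\<psi> \<phi> n. \<psi> n - \<phi> n"
  subgoal for \<psi> \<phi> using square_summable_add[of \<psi> UNIV "\<lambda>n. - \<phi> n"] by simp
  done
definition scaleR_ell2 :: "real \<Rightarrow> 'a ell2 \<Rightarrow> 'a ell2" where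
  "scaleR_ell2 r \<psi> = complex_of_real r *\<^sub>C \<psi>"

definition inner_ell2 :: "'a ell2 \<Rightarrow> 'a ell2 \<Rightarrow> real" where
  "inner_ell2 \<psi> \<phi> = Re (cinner_ell2 \<psi> \<phi>)"
definition norm_ell2 :: "'a ell2 \<Rightarrow> real" where
  "norm_ell2 \<psi> = sqrt (inner \<psi> \<psi>)"
definition dist_ell2 :: "'a ell2 \<Rightarrow> 'a ell2 \<Rightarrow> real" where
  "dist_ell2 \<psi> \<phi> = norm (\<psi> - \<phi>)"
definition sgn_ell2 :: "'a ell2 \<Rightarrow> 'a ell2" where
  "sgn_ell2 \<psi> = inverse (norm \<psi>) *\<^sub>R \<psi>"
definition uniformity_ell2 :: "('a ell2 \<times> 'a ell2) filter" where
  "uniformity_ell2 = (INF e\<in>{0<..}. principal {(x, y). dist x y < e})"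
definition open_ell2 :: "'a ell2 set \<Rightarrow> bool" where
  "open_ell2 U = (\<forall>x\<in>U. eventually (\<lambda>(x', y). x' = x \<longrightarrow> y \<in> U) uniformity)"

instance
proof
  fix \<psi> \<phi> \<eta> :: "'a ell2" and a b r :: real and U :: "'a ell2 set"
  note appl = plus_ell2.rep_eq zero_ell2.rep_eq uminus_ell2.rep_eq minus_ell2.rep_eq
    scaleC_ell2.rep_eq scaleR_ell2_def
  show "\<psi> + \<phi> + \<eta> = \<psi> + (\<phi> + \<eta>)" "\<psi> + \<phi> = \<phi> + \<psi>" "0 + \<psi> = \<psi>" "- \<psi> + \<psi> = 0"
    "\<psi> - \<phi> = \<psi> + - \<phi>" "a *\<^sub>R (\<psi> + \<phi>) = a *\<^sub>R \<psi> + a *\<^sub>R \<phi>"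
    "(a + b) *\<^sub>R \<psi> = a *\<^sub>R \<psi> + b *\<^sub>R \<psi>" "a *\<^sub>R b *\<^sub>R \<psi> = (a * b) *\<^sub>R \<psi>" "1 *\<^sub>R \<psi> = \<psi>"
    by (rule ell2_eqI; simp add: appl algebra_simps)+
  show "sgn \<psi> = inverse (norm \<psi>) *\<^sub>R \<psi>" by (simp add: sgn_ell2_def)
  show "dist \<psi> \<phi> = norm (\<psi> - \<phi>)" by (simp add: dist_ell2_def)
  show "(uniformity :: ('a ell2 \<times> 'a ell2) filter) =
      (INF e\<in>{0<..}. principal {(x, y). dist x y < e})"
    by (simp add: uniformity_ell2_def)
  show "open U = (\<forall>x\<in>U. \<forall>\<^sub>F (x', y) in uniformity. x' = x \<longrightarrow> y \<in> U)"
    by (simp add: open_ell2_def)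
  show "norm \<psi> = sqrt (inner \<psi> \<psi>)" by (simp add: norm_ell2_def)
  have "cinner_ell2 \<phi> \<psi> = cnj (cinner_ell2 \<psi> \<phi>)"
    unfolding cinner_ell2_def infsum_cnj[symmetric]
    by (intro infsum_cong) (simp add: mult.commute)
  then show "inner \<psi> \<phi> = inner \<phi> \<psi>" by (simp add: inner_ell2_def)
  show "inner (\<psi> + \<phi>) \<eta> = inner \<psi> \<eta> + inner \<phi> \<eta>"
    by (simp add: inner_ell2_def cinner_ell2_def plus_ell2.rep_eq distrib_right infsum_add
        cinner_ell2_summable)
  show "inner (r *\<^sub>R \<psi>) \<phi> = r * inner \<psi> \<phi>"
  proof -
    have "cinner_ell2 (r *\<^sub>R \<psi>) \<phi> = complex_of_real r * cinner_ell2 \<psi> \<phi>"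
      unfolding cinner_ell2_def infsum_cmult_right'[symmetric]
      by (intro infsum_cong) (simp add: scaleR_ell2_def scaleC_ell2.rep_eq)
    then show ?thesis by (simp add: inner_ell2_def)
  qed
  have *: "inner \<psi> \<psi> = (\<Sum>\<^sub>\<infinity>n. (cmod (ell2_apply \<psi> n))\<^sup>2)"
    unfolding inner_ell2_def cinner_ell2_def infsum_Re[OF cinner_ell2_summable, symmetric]
    by (intro infsum_cong) (simp add: cmod_power2 flip: power2_eq_square)
  show "0 \<le> inner \<psi> \<psi>" unfolding * by (intro infsum_nonneg) auto
  show "(inner \<psi> \<psi> = 0) = (\<psi> = 0)"
  proof
    assume "inner \<psi> \<psi> = 0"
    then have "(cmod (ell2_apply \<psi> n))\<^sup>2 = 0" for n
      unfolding * using nonneg_infsum_le_0D[OF _ ell2_summable, of \<psi> UNIV n] by simp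
    then show "\<psi> = 0" by (intro ell2_eqI) (simp add: appl)
  qed (unfold *, simp add: appl)
qed

end

lemma norm_ell2_eq: "norm \<psi> = sqrt (\<Sum>\<^sub>\<infinity>n. (cmod (ell2_apply \<psi> n))\<^sup>2)"
  unfolding norm_ell2_def inner_ell2_def cinner_ell2_def
    infsum_Re[OF cinner_ell2_summable, symmetric]
  by (intro arg_cong[where f = sqrt] infsum_cong) (simp add: cmod_power2 flip: power2_eq_square)

lemma finite_sum_le_norm_ell2:
  assumes "finite F"
  shows "(\<Sum>n\<in>F. (cmod (ell2_apply \<psi> n))\<^sup>2) \<le> (norm \<psi>)\<^sup>2"
proof -
  have "(\<Sum>n\<in>F. (cmod (ell2_apply \<psi> n))\<^sup>2) \<le> (\<Sum>\<^sub>\<infinity>n. (cmod (ell2_apply \<psi> n))\<^sup>2)"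
    by (rule finite_sum_le_infsum) (auto simp: assms ell2_summable)
  then show ?thesis by (simp add: norm_ell2_eq infsum_nonneg)
qed

lemma norm_ell2_leI:
  assumes "\<And>F. finite F \<Longrightarrow> (\<Sum>n\<in>F. (cmod (ell2_apply \<psi> n))\<^sup>2) \<le> B\<^sup>2" "0 \<le> B"
  shows "norm \<psi> \<le> B"
proof -
  have "(\<Sum>\<^sub>\<infinity>n. (cmod (ell2_apply \<psi> n))\<^sup>2) \<le> B\<^sup>2"
    by (rule infsum_le_finite_sums) (auto simp: assms ell2_summable)
  then show ?thesis using assms(2) by (simp add: norm_ell2_eq real_le_lsqrt infsum_nonneg)
qed

lemma norm_ell2_apply_le: "cmod (ell2_apply \<psi> n) \<le> norm \<psi>"
  using finite_sum_le_norm_ell2[of "{n}" \<psi>] by (simp add: power2_le_iff_abs_le)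

instance ell2 :: (type) banach
proof
  fix X :: "nat \<Rightarrow> 'a ell2"
  assume X: "Cauchy X"
  have "Cauchy (\<lambda>k. ell2_apply (X k) n)" for n
  proof (rule CauchyI)
    fix e :: real assume "0 < e"
    then obtain M where M: "\<And>j k. j \<ge> M \<Longrightarrow> k \<ge> M \<Longrightarrow> norm (X j - X k) < e"
      using X by (meson CauchyD)
    have "cmod (ell2_apply (X j) n - ell2_apply (X k) n) < e" if "j \<ge> M" "k \<ge> M" for j k
      using norm_ell2_apply_le[of "X j - X k" n] M[OF that] by (simp add: minus_ell2.rep_eq)
    then show "\<exists>M. \<forall>j\<ge>M. \<forall>k\<ge>M. norm (ell2_apply (X j) n - ell2_apply (X k) n) < e"
      by blast
  qed
  then obtain f where f: "\<And>n. (\<lambda>k. ell2_apply (X k) n) \<longlonglongrightarrow> f n"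
    unfolding Cauchy_convergent_iff convergent_def by metis
  have bnd: "(\<Sum>n\<in>F. (cmod (ell2_apply (X j) n - f n))\<^sup>2) \<le> e\<^sup>2"
    if "finite F" "0 < e" "\<And>k. k \<ge> M \<Longrightarrow> norm (X j - X k) < e" for F j M e
  proof (rule tendsto_upperbound)
    show "(\<lambda>k. \<Sum>n\<in>F. (cmod (ell2_apply (X j) n - ell2_apply (X k) n))\<^sup>2)
        \<longlonglongrightarrow> (\<Sum>n\<in>F. (cmod (ell2_apply (X j) n - f n))\<^sup>2)"
      by (intro tendsto_intros f)
    have "(\<Sum>n\<in>F. (cmod (ell2_apply (X j) n - ell2_apply (X k) n))\<^sup>2) \<le> e\<^sup>2" if "k \<ge> M" for k
    proof -
      have "(\<Sum>n\<in>F. (cmod (ell2_apply (X j - X k) n))\<^sup>2) \<le> (norm (X j - X k))\<^sup>2"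
        by (rule finite_sum_le_norm_ell2) fact
      also have "\<dots> \<le> e\<^sup>2"
        using \<open>\<And>k. k \<ge> M \<Longrightarrow> norm (X j - X k) < e\<close>[OF that] by (intro power_mono) auto
      finally show ?thesis by (simp add: minus_ell2.rep_eq)
    qed
    then show "\<forall>\<^sub>F k in sequentially.
        (\<Sum>n\<in>F. (cmod (ell2_apply (X j) n - ell2_apply (X k) n))\<^sup>2) \<le> e\<^sup>2"
      by (rule eventually_sequentiallyI)
  qed simp
  obtain M where M: "\<And>j k. j \<ge> M \<Longrightarrow> k \<ge> M \<Longrightarrow> norm (X j - X k) < 1"
    using X by (meson CauchyD zero_less_one)
  have "(\<lambda>n. (cmod (ell2_apply (X M) n - f n))\<^sup>2) summable_on UNIV"
  proof (rule nonneg_bdd_above_summable_on)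
    show "bdd_above (sum (\<lambda>n. (cmod (ell2_apply (X M) n - f n))\<^sup>2) ` {F. F \<subseteq> UNIV \<and> finite F})"
      using bnd[of _ 1 M M] M by (intro bdd_aboveI2[of _ _ 1]) auto
  qed simp
  then have "(\<lambda>n. (cmod (f n - ell2_apply (X M) n))\<^sup>2) summable_on UNIV"
    by (simp add: norm_minus_commute)
  from square_summable_add[OF this ell2_summable[of "X M"]]
  have "(\<lambda>n. (cmod (f n))\<^sup>2) summable_on UNIV" by simp
  then obtain \<psi> where \<psi>: "ell2_apply \<psi> = f"
    by (metis Abs_ell2_inverse mem_Collect_eq)
  have "X \<longlonglongrightarrow> \<psi>"
  proof (rule LIMSEQ_I)
    fix e :: real assume "0 < e"
    then obtain N where N: "\<And>j k. j \<ge> N \<Longrightarrow> k \<ge> N \<Longrightarrow> norm (X j - X k) < e / 2"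
      using X by (meson CauchyD half_gt_zero)
    have "norm (X j - \<psi>) \<le> e / 2" if "j \<ge> N" for j
      by (rule norm_ell2_leI)
        (use bnd[of _ "e / 2" N j] N[OF that] \<open>0 < e\<close> in \<open>auto simp: minus_ell2.rep_eq \<psi>\<close>)
    moreover have "e / 2 < e" using \<open>0 < e\<close> by simp
    ultimately show "\<exists>N. \<forall>j\<ge>N. norm (X j - \<psi>) < e"
      by (meson le_less_trans)
  qed
  then show "convergent X" by (rule convergentI)
qed

lemma norm_scaleC_ell2: "norm (c *\<^sub>C \<psi>) = cmod c * norm (\<psi> :: 'a ell2)"
  by (simp add: norm_ell2_eq scaleC_ell2.rep_eq norm_mult power_mult_distrib
      infsum_cmult_right ell2_summable real_sqrt_mult)

lemma cinner_delta: "cinner_ell2 (delta n) \<psi> = ell2_apply \<psi> n"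
proof -
  have "cinner_ell2 (delta n) \<psi> = (\<Sum>\<^sub>\<infinity>m\<in>{n}. ell2_apply \<psi> m)"
    unfolding cinner_ell2_def by (rule infsum_cong_neutral) (auto simp: delta.rep_eq)
  then show ?thesis by simp
qed


section \<open>Unitary group of a bounded operator\<close>

text \<open>\<open>unitary_group H t\<close> is \<open>exp (-itH)\<close> for a bounded operator \<open>H\<close>, given by the
  exponential series; \<open>unitary_group_summable\<close> shows that the series converges.\<close>

definition unitary_group :: "('a ell2 \<Rightarrow> 'a ell2) \<Rightarrow> real \<Rightarrow> 'a ell2 \<Rightarrow> 'a ell2" where
  "unitary_group H t \<psi> = (\<Sum>k. ((- \<i> * complex_of_real t) ^ k / fact k) *\<^sub>C (H ^^ k) \<psi>)"

lemma unitary_group_summable: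
  fixes H :: "'a ell2 \<Rightarrow> 'a ell2"
  assumes "bounded_linear H"
  shows "summable (\<lambda>k. ((- \<i> * complex_of_real t) ^ k / fact k) *\<^sub>C (H ^^ k) \<psi>)"
proof -
  obtain B where B: "\<And>\<phi>. norm (H \<phi>) \<le> norm \<phi> * B" "0 \<le> B"
    using bounded_linear.nonneg_bounded[OF assms] by blast
  have pow: "norm ((H ^^ k) \<psi>) \<le> B ^ k * norm \<psi>" for k
  proof (induction k)
    case (Suc k)
    have "norm (H ((H ^^ k) \<psi>)) \<le> norm ((H ^^ k) \<psi>) * B" by (rule B)
    also have "\<dots> \<le> (B ^ k * norm \<psi>) * B" by (intro mult_right_mono Suc B)
    finally show ?case by (simp add: mult_ac)
  qed simp
  show ?thesis
  proof (rule summable_comparison_test)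
    have "summable (\<lambda>k. (\<bar>t\<bar> * B) ^ k /\<^sub>R fact k)" by (rule summable_exp_generic)
    then show "summable (\<lambda>k. ((\<bar>t\<bar> * B) ^ k /\<^sub>R fact k) * norm \<psi>)" by (rule summable_mult2)
    have "norm (((- \<i> * complex_of_real t) ^ k / fact k) *\<^sub>C (H ^^ k) \<psi>)
        \<le> ((\<bar>t\<bar> * B) ^ k /\<^sub>R fact k) * norm \<psi>" for k
      using mult_left_mono[OF pow[of k], of "\<bar>t\<bar> ^ k / fact k"]
      by (simp add: norm_scaleC_ell2 norm_mult norm_power norm_divide power_mult_distrib field_simps)
    then show "\<exists>N. \<forall>k\<ge>N. norm (((- \<i> * complex_of_real t) ^ k / fact k) *\<^sub>C (H ^^ k) \<psi>)
        \<le> ((\<bar>t\<bar> * B) ^ k /\<^sub>R fact k) * norm \<psi>" by blast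
  qed
qed


section \<open>Schroedinger operators on the lattice\<close>

definition l1_norm :: "int ^ 'd \<Rightarrow> int" where
  "l1_norm n = (\<Sum>i\<in>UNIV. \<bar>n $ i\<bar>)"

lemma finite_l1_sphere: "finite {m :: int ^ 'd. l1_norm m = r}"
proof (rule finite_subset)
  have fin: "finite (Pi\<^sub>E (UNIV :: 'd set) (\<lambda>_. {-r..r}))" by (intro finite_PiE) auto
  show "finite (vec_lambda ` Pi\<^sub>E (UNIV :: 'd set) (\<lambda>_. {-r..r}))" by (rule finite_imageI[OF fin])
  show "{m :: int ^ 'd. l1_norm m = r} \<subseteq> vec_lambda ` Pi\<^sub>E (UNIV :: 'd set) (\<lambda>_. {-r..r})"
  proof
    fix m :: "int ^ 'd" assume "m \<in> {m. l1_norm m = r}"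
    then have "(\<Sum>i\<in>UNIV. \<bar>m $ i\<bar>) = r" by (simp add: l1_norm_def)
    then have "\<bar>m $ i\<bar> \<le> r" for i
      using member_le_sum[of i UNIV "\<lambda>i. \<bar>m $ i\<bar>"] by auto
    then have "vec_nth m \<in> Pi\<^sub>E UNIV (\<lambda>_. {-r..r})"
      by (auto simp: abs_le_iff minus_le_iff)
    then show "m \<in> vec_lambda ` Pi\<^sub>E UNIV (\<lambda>_. {-r..r})"
      by (metis image_eqI vec_nth_inverse)
  qed
qed

lemma sum_neighbours_shift:
  fixes \<psi> :: "int ^ 'd \<Rightarrow> complex"
  shows "(\<Sum>m | l1_norm (n - m) = 1. \<psi> m) = (\<Sum>e | l1_norm e = 1. \<psi> (n - e))"
  by (rule sum.reindex_bij_witness[of _ "\<lambda>e. n - e" "\<lambda>m. n - m"]) auto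

lemma square_summable_shift:
  fixes \<psi> :: "int ^ 'd \<Rightarrow> complex"
  assumes "(\<lambda>n. (cmod (\<psi> n))\<^sup>2) summable_on UNIV"
  shows "(\<lambda>n. (cmod (\<psi> (n - e)))\<^sup>2) summable_on UNIV"
proof -
  have "bij_betw (\<lambda>n. n - e) UNIV UNIV"
    by (rule bij_betw_byWitness[of _ "\<lambda>n. n + e"]) auto
  from summable_on_reindex_bij_betw[OF this, of "\<lambda>n. (cmod (\<psi> n))\<^sup>2"] show ?thesis
    using assms by simp
qed

lift_definition lattice_laplacian :: "(int ^ 'd) ell2 \<Rightarrow> (int ^ 'd) ell2"
  is "\<lambda>\<psi> n. \<Sum>m | l1_norm (n - m) = 1. \<psi> m"
  unfolding sum_neighbours_shift
  by (auto intro!: square_summable_sum square_summable_shift finite_l1_sphere)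

text \<open>Multiplication by a bounded function; for unbounded \<open>V\<close> the value is unspecified where
  \<open>V \<psi>\<close> is not square-summable. Periodic functions are bounded, so this does not arise below.\<close>

definition mult_op :: "('a \<Rightarrow> real) \<Rightarrow> 'a ell2 \<Rightarrow> 'a ell2" where
  "mult_op V \<psi> = Abs_ell2 (\<lambda>n. complex_of_real (V n) * ell2_apply \<psi> n)"

lemma mult_op_apply:
  assumes "bounded (range V)"
  shows "ell2_apply (mult_op V \<psi>) n = complex_of_real (V n) * ell2_apply \<psi> n"
proof -
  obtain B where "\<And>n. \<bar>V n\<bar> \<le> B" using assms by (auto simp: bounded_iff)
  then have "(\<lambda>n. (cmod (complex_of_real (V n) * ell2_apply \<psi> n))\<^sup>2) summable_on UNIV"
    by (intro square_summable_bounded_mult ell2_summable) simp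
  then show ?thesis by (simp add: mult_op_def Abs_ell2_inverse)
qed

definition schroedinger_op :: "real \<Rightarrow> (int ^ 'd \<Rightarrow> real) \<Rightarrow> (int ^ 'd) ell2 \<Rightarrow> (int ^ 'd) ell2" where
  "schroedinger_op \<mu> V \<psi> = lattice_laplacian \<psi> + \<mu> *\<^sub>R mult_op V \<psi>"


section \<open>Periodic potentials\<close>

definition periodic :: "nat ^ 'd \<Rightarrow> (int ^ 'd \<Rightarrow> real) \<Rightarrow> bool" where
  "periodic p V \<longleftrightarrow> (\<forall>n m. (\<forall>i. int (p $ i) dvd m $ i) \<longrightarrow> V (n + m) = V n)"

definition fundamental_cell :: "nat ^ 'd \<Rightarrow> (int ^ 'd) set" where
  "fundamental_cell p = {n. \<forall>i. n $ i \<in> {0..<int (p $ i)}}"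

definition nondegenerate :: "nat ^ 'd \<Rightarrow> (int ^ 'd \<Rightarrow> real) \<Rightarrow> bool" where
  "nondegenerate p V \<longleftrightarrow> inj_on V (fundamental_cell p)"

text \<open>The cell is finite, so the infimum is a minimum; over the empty set (a one-point cell) it is
  \<open>\<infinity>\<close>.\<close>

definition separation :: "nat ^ 'd \<Rightarrow> (int ^ 'd \<Rightarrow> real) \<Rightarrow> ereal" where
  "separation p V =
    (INF (n, m) \<in> {(n, m). n \<in> fundamental_cell p \<and> m \<in> fundamental_cell p \<and> n \<noteq> m}.
      ereal \<bar>V n - V m\<bar>)"

definition min_period :: "nat ^ 'd \<Rightarrow> nat" where
  "min_period p = Min (range (\<lambda>i. p $ i))"

lemma bounded_periodic:
  assumes "\<And>i. 1 \<le> p $ i" "periodic p V"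
  shows "bounded (range V)"
proof -
  have fin: "finite (fundamental_cell p)"
  proof (rule finite_subset)
    have "finite (Pi\<^sub>E (UNIV :: 'a set) (\<lambda>i. {0..<int (p $ i)}))" by (intro finite_PiE) auto
    then show "finite (vec_lambda ` Pi\<^sub>E (UNIV :: 'a set) (\<lambda>i. {0..<int (p $ i)}))"
      by (rule finite_imageI)
    show "fundamental_cell p \<subseteq> vec_lambda ` Pi\<^sub>E (UNIV :: 'a set) (\<lambda>i. {0..<int (p $ i)})"
    proof
      fix n assume "n \<in> fundamental_cell p"
      then have "vec_nth n \<in> Pi\<^sub>E UNIV (\<lambda>i. {0..<int (p $ i)})"
        by (auto simp: fundamental_cell_def)
      then show "n \<in> vec_lambda ` Pi\<^sub>E UNIV (\<lambda>i. {0..<int (p $ i)})"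
        by (metis image_eqI vec_nth_inverse)
    qed
  qed
  have "V n \<in> V ` fundamental_cell p" for n
  proof -
    let ?r = "\<chi> i. n $ i mod int (p $ i)"
    have "0 < int (p $ i)" for i using assms(1)[of i] by linarith
    then have "?r \<in> fundamental_cell p" by (simp add: fundamental_cell_def)
    moreover have "\<forall>i. int (p $ i) dvd (n - ?r) $ i"
      by (simp add: minus_mod_eq_mult_div)
    then have "V (?r + (n - ?r)) = V ?r"
      using assms(2) unfolding periodic_def by blast
    ultimately show ?thesis using image_eqI[of "V n" V ?r] by simp
  qed
  then show ?thesis by (meson fin finite_imageI finite_imp_bounded finite_subset image_subsetI)
qed

lift_definition shift_ell2 :: "int ^ 'd \<Rightarrow> (int ^ 'd) ell2 \<Rightarrow> (int ^ 'd) ell2"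
  is "\<lambda>e \<psi> n. \<psi> (n - e)"
  using square_summable_shift by blast

lemma norm_shift_ell2: "norm (shift_ell2 e \<psi>) = norm \<psi>"
proof -
  have "bij_betw (\<lambda>n. n - e) UNIV UNIV"
    by (rule bij_betw_byWitness[of _ "\<lambda>n. n + e"]) auto
  from infsum_reindex_bij_betw[OF this, of "\<lambda>n. (cmod (ell2_apply \<psi> n))\<^sup>2"] show ?thesis
    by (simp add: norm_ell2_eq shift_ell2.rep_eq)
qed

lemma ell2_apply_sum: "ell2_apply (\<Sum>s\<in>S. \<psi> s) n = (\<Sum>s\<in>S. ell2_apply (\<psi> s) n)"
  by (induction S rule: infinite_finite_induct) (simp_all add: zero_ell2.rep_eq plus_ell2.rep_eq)

lemma lattice_laplacian_eq_shifts:
  "lattice_laplacian \<psi> = (\<Sum>e | l1_norm e = 1. shift_ell2 e \<psi>)"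
  by (rule ell2_eqI)
    (simp only: lattice_laplacian.rep_eq ell2_apply_sum shift_ell2.rep_eq sum_neighbours_shift)

lemma bounded_linear_lattice_laplacian: "bounded_linear lattice_laplacian"
proof -
  have "bounded_linear (shift_ell2 e)" for e :: "int ^ 'd"
  proof (rule bounded_linear_intro[of _ 1])
    show "norm (shift_ell2 e \<psi>) \<le> norm \<psi> * 1" for \<psi> by (simp add: norm_shift_ell2)
  qed (rule ell2_eqI; simp add: shift_ell2.rep_eq plus_ell2.rep_eq scaleC_ell2.rep_eq
      scaleR_ell2_def)+
  then have "bounded_linear (\<lambda>\<psi>. \<Sum>e | l1_norm e = 1. shift_ell2 (e :: int ^ 'd) \<psi>)"
    by (intro bounded_linear_sum) auto
  then show ?thesis by (simp add: lattice_laplacian_eq_shifts[abs_def])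
qed

lemma bounded_linear_mult_op:
  assumes "bounded (range V)"
  shows "bounded_linear (mult_op V)"
proof -
  obtain B where B: "\<And>n. \<bar>V n\<bar> \<le> B" using assms by (auto simp: bounded_iff)
  then have B0: "0 \<le> B" by (meson abs_ge_zero order_trans)
  show ?thesis
  proof (rule bounded_linear_intro[of _ B])
    show "norm (mult_op V \<psi>) \<le> norm \<psi> * B" for \<psi>
    proof (rule norm_ell2_leI)
      fix F :: "'a set" assume F: "finite F"
      have "(\<Sum>n\<in>F. (cmod (ell2_apply (mult_op V \<psi>) n))\<^sup>2)
          \<le> (\<Sum>n\<in>F. B\<^sup>2 * (cmod (ell2_apply \<psi> n))\<^sup>2)"
        using B by (auto simp: mult_op_apply[OF assms] norm_mult power_mult_distrib B0
            simp flip: abs_le_square_iff intro!: sum_mono mult_right_mono abs_le_square_iff[THEN iffD1])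
      also have "\<dots> \<le> B\<^sup>2 * (norm \<psi>)\<^sup>2"
        using finite_sum_le_norm_ell2[OF F, of \<psi>]
        by (simp add: mult_left_mono flip: sum_distrib_left)
      finally show "(\<Sum>n\<in>F. (cmod (ell2_apply (mult_op V \<psi>) n))\<^sup>2) \<le> (norm \<psi> * B)\<^sup>2"
        by (simp add: power_mult_distrib mult.commute)
    qed (simp add: B0)
  qed (rule ell2_eqI; simp add: mult_op_apply[OF assms] plus_ell2.rep_eq scaleC_ell2.rep_eq
      scaleR_ell2_def algebra_simps)+
qed

lemma bounded_linear_schroedinger_op:
  assumes "bounded (range V)"
  shows "bounded_linear (schroedinger_op \<mu> V)"
  unfolding schroedinger_op_def[abs_def]
  by (intro bounded_linear_add bounded_linear_lattice_laplacian bounded_linear_scaleR_right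
      bounded_linear_compose[OF bounded_linear_scaleR_right] bounded_linear_mult_op assms)

end

theory Submission
  imports Defs
begin

text \<open>Upper bound. Conjugating \<open>H\<close> with the weight \<open>exp (\<rho> \<bullet> n)\<close>, where \<open>\<rho>\<close> has entries \<open>\<plusminus>\<rho>\<^sub>0\<close>, turns the
  claim into a growth bound for the unitary group of a non-selfadjoint operator \<open>H\<^sub>\<rho>\<close>, still with real
  coefficients. As long as the displacement stays below the smallest period \<open>P\<close> there are no
  resonances, so at every site there is an approximate left eigenvector of \<open>H\<^sub>\<rho>\<close> with real eigenvalue
  and error \<open>O(\<mu>\<^sup>1\<^sup>-\<^sup>P)\<close>. These vectors are the rows of an operator \<open>S = 1 + O(1/\<mu>)\<close> with
  \<open>S H\<^sub>\<rho> = D S + O(\<mu>\<^sup>1\<^sup>-\<^sup>P)\<close>, \<open>D\<close> real and diagonal, and a Gronwall estimate for \<open>S\<close> applied to the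
  evolution under \<open>H\<^sub>\<rho>\<close> concludes.

  Optimality. Let direction \<open>i\<close> have period \<open>P\<close>, let \<open>U\<close> be the translation by this period and \<open>X\<close> the
  \<open>i\<close>-th position. The trace per cell of \<open>U\<^sup>* H\<^sup>P\<^sup>-\<^sup>1 [X, H]\<close> counts the single straight path from \<open>m\<close> to
  its translate, so it is \<open>1\<close>. Since \<open>U\<close> and \<open>H\<close> commute with the evolution, integrating in time
  shows that \<open>t\<close> is at most \<open>\<parallel>H\<parallel>\<^sup>P\<^sup>-\<^sup>1\<close> times the norm of the columns of \<open>[X, e\<^sup>-\<^sup>i\<^sup>t\<^sup>H]\<close>, and a
  Lieb-Robinson bound with velocity \<open>v\<close> makes the latter at most \<open>2 v t + O(1)\<close>. Hence
  \<open>1 \<le> 2 v \<parallel>H\<parallel>\<^sup>P\<^sup>-\<^sup>1\<close>, where \<open>\<parallel>H\<parallel> = O(\<mu>)\<close>.\<close>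

section \<open>Exponential series in the Hilbert space\<close>

lemmas ell2_apply_simps =
  zero_ell2.rep_eq plus_ell2.rep_eq minus_ell2.rep_eq uminus_ell2.rep_eq scaleC_ell2.rep_eq

lemma ell2_apply_scaleR [simp]: "ell2_apply (r *\<^sub>R \<psi>) n = of_real r * ell2_apply \<psi> n"
  by (simp add: scaleR_ell2_def scaleC_ell2.rep_eq)

section \<open>Complex scalars and the real inner product\<close>

lemma bounded_linear_scaleC: "bounded_linear (\<lambda>\<psi>. c *\<^sub>C \<psi>)"
  by (rule bounded_linear_intro[of _ "cmod c"])
    (auto intro!: ell2_eqI simp: norm_scaleC_ell2 ell2_apply_simps algebra_simps)

lemma scaleC_scaleC [simp]: "a *\<^sub>C b *\<^sub>C \<psi> = (a * b) *\<^sub>C \<psi>"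
  by (rule ell2_eqI) (simp add: ell2_apply_simps)

lemma scaleC_minus_left: "(- a) *\<^sub>C \<psi> = - (a *\<^sub>C \<psi>)"
  by (rule ell2_eqI) (simp add: ell2_apply_simps)

lemma scaleC_minus_one [simp]: "(-1) *\<^sub>C \<psi> = - \<psi>"
  by (rule ell2_eqI) (simp add: ell2_apply_simps)

lemma scaleC_one [simp]: "1 *\<^sub>C \<psi> = \<psi>"
  by (rule ell2_eqI) (simp add: ell2_apply_simps)

lemma scaleC_zero_left [simp]: "0 *\<^sub>C \<psi> = 0"
  by (rule ell2_eqI) (simp add: ell2_apply_simps)

lemma scaleC_zero_right [simp]: "c *\<^sub>C 0 = 0"
  by (rule ell2_eqI) (simp add: ell2_apply_simps)

lemma scaleC_add_left: "(a + b) *\<^sub>C \<psi> = a *\<^sub>C \<psi> + b *\<^sub>C \<psi>"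
  by (rule ell2_eqI) (simp add: ell2_apply_simps algebra_simps)

lemma scaleC_of_real: "of_real r *\<^sub>C \<psi> = r *\<^sub>R \<psi>"
  by (simp add: scaleR_ell2_def)

lemmas scaleC_sum = linear_sum[OF bounded_linear.linear[OF bounded_linear_scaleC]]
lemmas scaleC_add = linear_add[OF bounded_linear.linear[OF bounded_linear_scaleC]]
lemmas scaleC_minus = linear_neg[OF bounded_linear.linear[OF bounded_linear_scaleC]]

lemma inner_ell2_Re: "inner \<psi> \<phi> = Re (\<Sum>\<^sub>\<infinity>n. cnj (ell2_apply \<psi> n) * ell2_apply \<phi> n)"
  by (simp add: inner_ell2_def cinner_ell2_def)

lemma inner_scaleC_ii: "inner (\<i> *\<^sub>C \<psi>) (\<i> *\<^sub>C \<phi>) = inner \<psi> \<phi>"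
  unfolding inner_ell2_Re
  by (intro arg_cong[where f = Re] infsum_cong) (simp add: scaleC_ell2.rep_eq complex_eq_iff)

text \<open>The real inner product is the real part of the complex one, so multiplication by
  \<open>\<i>\<close> is an isometry with square -1 and hence skew-adjoint.\<close>

lemma inner_scaleC_ii_left: "inner (\<i> *\<^sub>C \<psi>) \<phi> = - inner \<psi> (\<i> *\<^sub>C \<phi>)"
  using inner_scaleC_ii[of \<psi> "\<i> *\<^sub>C \<phi>"] by simp

lemma inner_delta_left: "inner (delta n) \<psi> = Re (ell2_apply \<psi> n)"
  by (simp add: inner_ell2_def cinner_delta)

lemma inner_delta_right: "inner \<psi> (delta n) = Re (ell2_apply \<psi> n)"
  by (subst inner_commute) (rule inner_delta_left)

lemma norm_delta [simp]: "norm (delta n) = 1"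
  by (simp add: norm_eq_sqrt_inner inner_delta_left delta.rep_eq)

text \<open>The type class supplies only real linearity. Commutation with complex scalars is
  recorded separately because operators must pass through the complex coefficients of the
  exponential series.\<close>

definition complex_bounded_linear :: "('a ell2 \<Rightarrow> 'b ell2) \<Rightarrow> bool" where
  "complex_bounded_linear T \<longleftrightarrow> bounded_linear T \<and> (\<forall>c \<psi>. T (c *\<^sub>C \<psi>) = c *\<^sub>C T \<psi>)"

lemma complex_bounded_linearD:
  assumes "complex_bounded_linear T"
  shows "bounded_linear T" "T (c *\<^sub>C \<psi>) = c *\<^sub>C T \<psi>"
  using assms by (auto simp: complex_bounded_linear_def)

lemma bounded_linear_ell2_apply: "bounded_linear (\<lambda>\<psi>. ell2_apply \<psi> n)"
  by (rule bounded_linear_intro[of _ 1])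
    (auto simp: ell2_apply_simps norm_ell2_apply_le scaleR_conv_of_real)

text \<open>The sequence need not consist of powers of one operator applied to one vector. This
  freedom is used for the position-weighted powers behind \<open>displacement\<close>.\<close>

definition exp_series :: "(nat \<Rightarrow> 'a ell2) \<Rightarrow> real \<Rightarrow> 'a ell2" where
  "exp_series v t = (\<Sum>k. ((- \<i> * complex_of_real t) ^ k / fact k) *\<^sub>C v k)"

definition geometric_growth :: "(nat \<Rightarrow> 'a ell2) \<Rightarrow> bool" where
  "geometric_growth v \<longleftrightarrow> (\<exists>M B. \<forall>k. norm (v k) \<le> M * B ^ k)"

lemma geometric_growthE:
  assumes "geometric_growth v"
  obtains M B where "\<And>k. norm (v k) \<le> M * B ^ k" "0 \<le> M" "0 \<le> B"
proof -
  obtain M B where MB: "\<And>k. norm (v k) \<le> M * B ^ k"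
    using assms by (auto simp: geometric_growth_def)
  have "norm (v k) \<le> \<bar>M\<bar> * \<bar>B\<bar> ^ k" for k
  proof -
    have "M * B ^ k \<le> \<bar>M * B ^ k\<bar>" by simp
    also have "\<dots> = \<bar>M\<bar> * \<bar>B\<bar> ^ k" by (simp add: abs_mult power_abs)
    finally show ?thesis using MB[of k] by linarith
  qed
  then show ?thesis by (rule that) auto
qed

lemma geometric_growth_Suc:
  assumes "geometric_growth v"
  shows "geometric_growth (\<lambda>k. v (Suc k))"
proof -
  obtain M B where MB: "\<And>k. norm (v k) \<le> M * B ^ k"
    using geometric_growthE[OF assms] by metis
  have "norm (v (Suc k)) \<le> (M * B) * B ^ k" for k using MB[of "Suc k"] by (simp add: mult_ac)
  then show ?thesis by (auto simp: geometric_growth_def)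
qed

lemma geometric_growth_bounded_linear:
  assumes "geometric_growth v" "bounded_linear T"
  shows "geometric_growth (\<lambda>k. T (v k))"
proof -
  obtain M B where MB: "\<And>k. norm (v k) \<le> M * B ^ k"
    using geometric_growthE[OF assms(1)] by metis
  obtain K where K: "\<And>x. norm (T x) \<le> norm x * K" "0 \<le> K"
    using bounded_linear.nonneg_bounded[OF assms(2)] by blast
  have "norm (T (v k)) \<le> (M * K) * B ^ k" for k
  proof -
    have "norm (T (v k)) \<le> norm (v k) * K" by (rule K)
    also have "\<dots> \<le> (M * B ^ k) * K" using MB K by (intro mult_right_mono)
    finally show ?thesis by (simp add: mult_ac)
  qed
  then show ?thesis by (auto simp: geometric_growth_def)
qed

lemma geometric_growth_add:
  assumes "geometric_growth v" "geometric_growth w"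
  shows "geometric_growth (\<lambda>k. v k + w k)"
proof -
  obtain M B where MB: "\<And>k. norm (v k) \<le> M * B ^ k" "0 \<le> M" "0 \<le> B"
    using geometric_growthE[OF assms(1)] by metis
  obtain M' B' where MB': "\<And>k. norm (w k) \<le> M' * B' ^ k" "0 \<le> M'" "0 \<le> B'"
    using geometric_growthE[OF assms(2)] by metis
  have "norm (v k + w k) \<le> (M + M') * max B B' ^ k" for k
  proof -
    have "norm (v k + w k) \<le> M * B ^ k + M' * B' ^ k"
      using norm_triangle_ineq[of "v k" "w k"] MB(1)[of k] MB'(1)[of k] by linarith
    also have "\<dots> \<le> M * max B B' ^ k + M' * max B B' ^ k"
      using MB MB' by (intro add_mono mult_left_mono power_mono) auto
    finally show ?thesis by (simp add: distrib_right)
  qed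
  then show ?thesis by (auto simp: geometric_growth_def)
qed

lemma geometric_growth_sum:
  assumes "\<And>i. i \<in> I \<Longrightarrow> geometric_growth (f i)"
  shows "geometric_growth (\<lambda>k. \<Sum>i\<in>I. f i k)"
  using assms
proof (induction I rule: infinite_finite_induct)
  case (insert i I)
  then show ?case by (simp add: geometric_growth_add)
qed (auto simp: geometric_growth_def intro!: exI[of _ 0])

lemma geometric_growth_scaleR:
  assumes "geometric_growth v"
  shows "geometric_growth (\<lambda>k. c *\<^sub>R v k)"
  by (rule geometric_growth_bounded_linear[OF assms bounded_linear_scaleR_right])

lemma norm_funpow_le:
  fixes T :: "'a::real_normed_vector \<Rightarrow> 'a"
  assumes "\<And>\<psi>. norm (T \<psi>) \<le> B * norm \<psi>" "0 \<le> B"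
  shows "norm ((T ^^ k) \<psi>) \<le> B ^ k * norm \<psi>"
proof (induction k)
  case (Suc k)
  have "norm (T ((T ^^ k) \<psi>)) \<le> B * norm ((T ^^ k) \<psi>)" by (rule assms)
  also have "\<dots> \<le> B * (B ^ k * norm \<psi>)" by (intro mult_left_mono Suc assms)
  finally show ?case by (simp add: mult_ac)
qed simp

lemma geometric_growth_funpow:
  fixes H :: "'a ell2 \<Rightarrow> 'a ell2"
  assumes "bounded_linear H"
  shows "geometric_growth (\<lambda>k. (H ^^ k) \<psi>)"
proof -
  obtain B where "\<And>\<phi>. norm (H \<phi>) \<le> norm \<phi> * B" "0 \<le> B"
    using bounded_linear.nonneg_bounded[OF assms] by blast
  then have "norm ((H ^^ k) \<psi>) \<le> norm \<psi> * B ^ k" for k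
    using norm_funpow_le[of H B k \<psi>] by (simp add: mult.commute)
  then show ?thesis unfolding geometric_growth_def by blast
qed

text \<open>Uniform in \<bar>t\<bar> \<le> T, so that it yields both convergence at a point and the
  majorant for term-by-term differentiation.\<close>

lemma exp_series_summand_le:
  assumes "\<And>k. norm (v k) \<le> M * B ^ k" "0 \<le> M" "0 \<le> B" "\<bar>t\<bar> \<le> T"
  shows "norm (((- \<i> * complex_of_real t) ^ k / fact k) *\<^sub>C v k) \<le> ((T * B) ^ k /\<^sub>R fact k) * M"
proof -
  have "norm (((- \<i> * complex_of_real t) ^ k / fact k) *\<^sub>C v k) = \<bar>t\<bar> ^ k / fact k * norm (v k)"
    by (simp add: norm_scaleC_ell2 norm_mult norm_power norm_divide)
  also have "\<dots> \<le> T ^ k / fact k * (M * B ^ k)"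
    using assms by (intro mult_mono divide_right_mono power_mono) auto
  finally show ?thesis by (simp add: power_mult_distrib field_simps)
qed

lemma exp_series_summable:
  assumes "geometric_growth v"
  shows "summable (\<lambda>k. ((- \<i> * complex_of_real t) ^ k / fact k) *\<^sub>C v k)"
proof -
  obtain M B where MB: "\<And>k. norm (v k) \<le> M * B ^ k" "0 \<le> M" "0 \<le> B"
    using geometric_growthE[OF assms] by metis
  show ?thesis
  proof (rule summable_comparison_test)
    show "summable (\<lambda>k. ((\<bar>t\<bar> * B) ^ k /\<^sub>R fact k) * M)"
      by (intro summable_mult2 summable_exp_generic)
    show "\<exists>N. \<forall>k\<ge>N. norm (((- \<i> * complex_of_real t) ^ k / fact k) *\<^sub>C v k)
        \<le> ((\<bar>t\<bar> * B) ^ k /\<^sub>R fact k) * M"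
      using exp_series_summand_le[OF MB] by blast
  qed
qed

lemma exp_series_0: "exp_series v 0 = v 0"
proof -
  have "(\<lambda>k. ((- \<i> * complex_of_real 0) ^ k / fact k) *\<^sub>C v k) = (\<lambda>k. if k = 0 then v 0 else 0)"
    by (auto simp: fun_eq_iff power_0_left)
  then show ?thesis
    unfolding exp_series_def using suminf_finite[of "{0::nat}" "\<lambda>k. if k = 0 then v 0 else 0"] by simp
qed

lemma exp_series_bounded_linear:
  assumes "geometric_growth v" "complex_bounded_linear T"
  shows "T (exp_series v t) = exp_series (\<lambda>k. T (v k)) t"
  unfolding exp_series_def complex_bounded_linearD(2)[OF assms(2), symmetric]
  by (rule bounded_linear.suminf[OF complex_bounded_linearD(1)[OF assms(2)] exp_series_summable[OF assms(1)]])

lemma ell2_apply_exp_series: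
  assumes "geometric_growth v"
  shows "ell2_apply (exp_series v t) n = (\<Sum>k. (- \<i> * complex_of_real t) ^ k / fact k * ell2_apply (v k) n)"
  unfolding exp_series_def bounded_linear.suminf[OF bounded_linear_ell2_apply exp_series_summable[OF assms]]
  by (simp add: scaleC_ell2.rep_eq)

lemma exp_series_sum:
  assumes "\<And>i. i \<in> I \<Longrightarrow> geometric_growth (f i)"
  shows "exp_series (\<lambda>k. \<Sum>i\<in>I. f i k) t = (\<Sum>i\<in>I. exp_series (f i) t)"
  unfolding exp_series_def scaleC_sum
  by (rule suminf_sum) (use exp_series_summable[OF assms] in auto)

lemma exp_series_add:
  assumes "geometric_growth v" "geometric_growth w"
  shows "exp_series (\<lambda>k. v k + w k) t = exp_series v t + exp_series w t"
  unfolding exp_series_def scaleC_add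
  by (rule suminf_add[symmetric]) (use exp_series_summable assms in auto)

lemma exp_series_scaleC:
  assumes "geometric_growth v"
  shows "exp_series (\<lambda>k. c *\<^sub>C v k) t = c *\<^sub>C exp_series v t"
  by (rule exp_series_bounded_linear[OF assms, symmetric])
    (simp add: complex_bounded_linear_def bounded_linear_scaleC mult.commute)

lemma exp_series_scaleR:
  assumes "geometric_growth v"
  shows "exp_series (\<lambda>k. c *\<^sub>R v k) t = c *\<^sub>R exp_series v t"
  using exp_series_scaleC[OF assms, of "of_real c" t] by (simp add: scaleC_of_real)

text \<open>Differentiating a term lowers its power by one and cancels a factor of the factorial,
  which shifts the sequence by one index. The differentiated series converges uniformly on the unit
  ball around t.\<close>

lemma exp_series_has_vector_derivative:
  assumes "geometric_growth v"
  shows "(exp_series v has_vector_derivative - (\<i> *\<^sub>C exp_series (\<lambda>k. v (Suc k)) t)) (at t)"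
proof -
  define c where "c = (\<lambda>k t. (- \<i> * complex_of_real t) ^ k / fact k)"
  define f where "f = (\<lambda>k t. c k t *\<^sub>C v k)"
  define d where "d = (\<lambda>k t. (case k of 0 \<Rightarrow> 0 | Suc j \<Rightarrow> (- \<i>) *\<^sub>C c j t *\<^sub>C v k))"
  define g' where "g' = (\<lambda>x. - (\<i> *\<^sub>C exp_series (\<lambda>k. v (Suc k)) x))"
  define S where "S = ball t 1"
  obtain M B where MB: "\<And>k. norm (v (Suc k)) \<le> M * B ^ k" "0 \<le> M" "0 \<le> B"
    using geometric_growthE[OF geometric_growth_Suc[OF assms]] by metis
  have fd: "(f k has_vector_derivative d k x) (at x)" for k x
  proof -
    have "(c k has_vector_derivative (case k of 0 \<Rightarrow> 0 | Suc j \<Rightarrow> - \<i> * c j x)) (at x)"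
    proof (cases k)
      case (Suc j)
      have "((\<lambda>z. (- \<i> * z) ^ Suc j / fact (Suc j)) has_field_derivative - \<i> * c j x) (at (complex_of_real x))"
      proof -
        have "((\<lambda>z. (- \<i> * z) ^ Suc j / fact (Suc j)) has_field_derivative
            of_nat (Suc j) * (- \<i>) * (- \<i> * of_real x) ^ j / fact (Suc j)) (at (complex_of_real x))"
          by (rule derivative_eq_intros refl | simp del: of_nat_Suc fact_Suc)+
        also have "of_nat (Suc j) * (- \<i>) * (- \<i> * of_real x) ^ j / fact (Suc j) = - \<i> * c j x"
          unfolding c_def fact_Suc by (simp del: of_nat_Suc)
        finally show ?thesis .
      qed
      from has_vector_derivative_real_field[OF this] show ?thesis by (simp add: Suc c_def)
    qed (simp add: c_def)
    moreover have "bounded_linear (\<lambda>z. z *\<^sub>C v k)"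
      by (rule bounded_linear_intro[of _ "norm (v k)"])
        (simp_all add: scaleC_add_left norm_scaleC_ell2 flip: scaleC_of_real, simp add: scaleR_conv_of_real)
    ultimately show ?thesis
      unfolding f_def d_def
      by (auto dest: bounded_linear.has_vector_derivative split: nat.split simp: scaleC_minus_left)
  qed
  have "\<exists>g. \<forall>x\<in>S. (\<lambda>n. f n x) sums g x \<and> (g has_derivative (\<lambda>h. h *\<^sub>R g' x)) (at x within S)"
  proof (rule has_derivative_series[where f' = "\<lambda>n x h. h *\<^sub>R d n x" and x = t])
    show "(f n has_derivative (\<lambda>h. h *\<^sub>R d n x)) (at x within S)" for n x
      using fd[of n x] has_derivative_at_withinI unfolding has_vector_derivative_def by blast
    show "(\<lambda>n. f n t) sums exp_series v t"
      using exp_series_summable[OF assms, of t] by (simp add: exp_series_def f_def c_def summable_sums)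
    define T where "T = \<bar>t\<bar> + 1"
    have dle: "norm (d (Suc n) x) \<le> ((T * B) ^ n /\<^sub>R fact n) * M" if "x \<in> S" for n x
    proof -
      have "\<bar>x\<bar> \<le> T" using that unfolding S_def T_def by (auto simp: dist_real_def)
      from exp_series_summand_le[OF MB this, of n]
      show ?thesis by (simp add: d_def c_def norm_scaleC_ell2 norm_mult norm_divide norm_power)
    qed
    have "uniform_limit S (\<lambda>n x. \<Sum>i<n. d (Suc i) x) (\<lambda>x. \<Sum>i. d (Suc i) x) sequentially"
      by (rule Weierstrass_m_test[OF dle summable_mult2[OF summable_exp_generic]])
    moreover have "(\<Sum>i. d (Suc i) x) = g' x" for x
    proof -
      have "(\<Sum>i. d (Suc i) x) = (\<Sum>i. (- \<i>) *\<^sub>C (((- \<i> * complex_of_real x) ^ i / fact i) *\<^sub>C v (Suc i)))"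
        by (simp add: d_def c_def)
      also have "\<dots> = (- \<i>) *\<^sub>C exp_series (\<lambda>k. v (Suc k)) x"
        unfolding exp_series_def
        by (rule bounded_linear.suminf[OF bounded_linear_scaleC, symmetric])
          (rule exp_series_summable[OF geometric_growth_Suc[OF assms]])
      finally show ?thesis by (simp add: g'_def scaleC_minus_left)
    qed
    ultimately have ul: "uniform_limit S (\<lambda>n x. \<Sum>i<n. d (Suc i) x) g' sequentially" by simp
    fix e :: real assume "e > 0"
    then have "\<forall>\<^sub>F n in sequentially. \<forall>x\<in>S. dist (\<Sum>i<n. d (Suc i) x) (g' x) < e"
      using ul uniform_limitD by blast
    \<comment> \<open>The constant term has derivative \<open>d 0 x = 0\<close>, so prepending it
      leaves the partial sums unchanged and only shifts their index.\<close>
    then have "\<forall>\<^sub>F n in sequentially. \<forall>x\<in>S. dist (\<Sum>i<Suc n. d i x) (g' x) < e"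
    proof eventually_elim
      case (elim n)
      then show ?case by (simp only: sum.lessThan_Suc_shift) (simp add: d_def)
    qed
    then have "\<forall>\<^sub>F n in sequentially. \<forall>x\<in>S. dist (\<Sum>i<n. d i x) (g' x) < e"
      by (simp only: eventually_sequentially_Suc[where P = "\<lambda>n. \<forall>x\<in>S. dist (\<Sum>i<n. d i x) (g' x) < e"])
    then show "\<forall>\<^sub>F n in sequentially. \<forall>x\<in>S. \<forall>h. norm ((\<Sum>i<n. h *\<^sub>R d i x) - h *\<^sub>R g' x) \<le> e * norm h"
    proof eventually_elim
      case (elim n)
      have "norm ((\<Sum>i<n. h *\<^sub>R d i x) - h *\<^sub>R g' x) = norm ((\<Sum>i<n. d i x) - g' x) * \<bar>h\<bar>" for h x
        by (simp add: mult.commute flip: scaleR_sum_right scaleR_diff_right)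
      then show ?case using elim by (auto simp: dist_norm less_imp_le intro!: mult_right_mono)
    qed
  qed (auto simp: S_def)
  then obtain g where g: "\<And>x. x \<in> S \<Longrightarrow> (\<lambda>n. f n x) sums g x"
    "\<And>x. x \<in> S \<Longrightarrow> (g has_derivative (\<lambda>h. h *\<^sub>R g' x)) (at x within S)" by blast
  have eq: "g x = exp_series v x" if "x \<in> S" for x
    using sums_unique[OF g(1)[OF that]] by (simp add: exp_series_def f_def c_def)
  have "t \<in> S" "open S" by (auto simp: S_def)
  then have "(g has_derivative (\<lambda>h. h *\<^sub>R g' t)) (at t)" using g(2) at_within_open by metis
  then have "(exp_series v has_derivative (\<lambda>h. h *\<^sub>R g' t)) (at t)"
    by (rule has_derivative_transform_within_open[OF _ \<open>open S\<close> \<open>t \<in> S\<close> eq])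
  then show ?thesis by (simp add: has_vector_derivative_def g'_def)
qed

lemma unitary_group_eq: "unitary_group H t \<psi> = exp_series (\<lambda>k. (H ^^ k) \<psi>) t"
  by (simp add: unitary_group_def exp_series_def)

lemma unitary_group_has_vector_derivative:
  assumes "complex_bounded_linear H"
  shows "((\<lambda>t. unitary_group H t \<psi>) has_vector_derivative - (\<i> *\<^sub>C H (unitary_group H t \<psi>))) (at t)"
  using exp_series_has_vector_derivative[OF geometric_growth_funpow[OF complex_bounded_linearD(1)[OF assms]], of \<psi> t]
    exp_series_bounded_linear[OF geometric_growth_funpow[OF complex_bounded_linearD(1)[OF assms]] assms, of \<psi> t]
  by (simp add: unitary_group_eq[abs_def])

lemma has_real_derivative_inner:
  assumes "(f has_vector_derivative f') (at t)" "(g has_vector_derivative g') (at t)"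
  shows "((\<lambda>x. inner (f x) (g x)) has_real_derivative inner (f t) g' + inner f' (g t)) (at t)"
  using bounded_bilinear.has_vector_derivative[OF bounded_bilinear_inner assms]
  by (simp add: has_real_derivative_iff_has_vector_derivative)

section \<open>Weighted Schroedinger operators\<close>

lemma l1_norm_nonneg [simp]: "0 \<le> l1_norm n"
  by (simp add: l1_norm_def sum_nonneg)

lemma l1_norm_zero [simp]: "l1_norm 0 = 0"
  by (simp add: l1_norm_def)

lemma l1_norm_eq_0_iff [simp]: "l1_norm n = 0 \<longleftrightarrow> n = 0"
  by (simp add: l1_norm_def sum_nonneg_eq_0_iff vec_eq_iff)

lemma l1_norm_minus [simp]: "l1_norm (- n) = l1_norm n"
  by (simp add: l1_norm_def)

lemma l1_norm_triangle: "l1_norm (n + m) \<le> l1_norm n + l1_norm m"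
  unfolding l1_norm_def by (simp flip: sum.distrib add: sum_mono)

lemma l1_norm_triangle_diff: "l1_norm n \<le> l1_norm (n - m) + l1_norm m"
  using l1_norm_triangle[of "n - m" m] by simp

lemma abs_component_le_l1_norm: "\<bar>n $ i\<bar> \<le> l1_norm n"
  unfolding l1_norm_def by (rule member_le_sum) auto

lemma l1_norm_axis [simp]: "l1_norm (axis i k) = \<bar>k\<bar>"
  unfolding l1_norm_def by (subst sum.remove[of _ i]) (auto simp: axis_def intro!: sum.neutral)

lemma unit_vector_eq_axis:
  assumes "l1_norm e = 1" "\<bar>e $ i\<bar> = 1"
  shows "e = axis i (e $ i)"
proof -
  have "\<bar>e $ i\<bar> + (\<Sum>j\<in>UNIV - {i}. \<bar>e $ j\<bar>) = 1"
    using assms(1) unfolding l1_norm_def by (subst (asm) sum.remove[of _ i]) auto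
  then have "(\<Sum>j\<in>UNIV - {i}. \<bar>e $ j\<bar>) = 0" using assms(2) by simp
  then have "\<forall>j\<in>UNIV - {i}. \<bar>e $ j\<bar> = 0" by (subst (asm) sum_nonneg_eq_0_iff) auto
  then show ?thesis by (auto simp: vec_eq_iff axis_def)
qed

lemma finite_l1_ball: "finite {e :: int ^ 'd. l1_norm e < r}"
proof (rule finite_subset)
  show "{e. l1_norm e < r} \<subseteq> (\<Union>k\<in>{0..<r}. {e :: int ^ 'd. l1_norm e = k})" by auto
  show "finite (\<Union>k\<in>{0..<r}. {e :: int ^ 'd. l1_norm e = k})"
    by (intro finite_UN_I finite_l1_sphere) auto
qed

section \<open>Shifts and multiplication operators\<close>

lemma complex_bounded_linear_add:
  assumes "complex_bounded_linear S" "complex_bounded_linear T"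
  shows "complex_bounded_linear (\<lambda>\<psi>. S \<psi> + T \<psi>)"
  using assms by (simp add: complex_bounded_linear_def bounded_linear_add scaleC_add)

lemma complex_bounded_linear_sum:
  assumes "\<And>i. i \<in> I \<Longrightarrow> complex_bounded_linear (T i)"
  shows "complex_bounded_linear (\<lambda>\<psi>. \<Sum>i\<in>I. T i \<psi>)"
  using assms by (auto simp: complex_bounded_linear_def scaleC_sum intro!: bounded_linear_sum)

lemma complex_bounded_linear_compose:
  assumes "complex_bounded_linear S" "complex_bounded_linear T"
  shows "complex_bounded_linear (\<lambda>\<psi>. S (T \<psi>))"
  using assms by (simp add: complex_bounded_linear_def bounded_linear_compose)

lemma complex_bounded_linear_scaleR:
  assumes "complex_bounded_linear T"
  shows "complex_bounded_linear (\<lambda>\<psi>. r *\<^sub>R T \<psi>)"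
  using assms
  by (auto simp: complex_bounded_linear_def bounded_linear_compose[OF bounded_linear_scaleR_right]
      intro!: ell2_eqI) (simp add: ell2_apply_simps)

lemma complex_bounded_linear_shift: "complex_bounded_linear (shift_ell2 e)"
proof -
  have "bounded_linear (shift_ell2 e)"
    by (rule bounded_linear_intro[of _ 1])
      (auto intro!: ell2_eqI simp: shift_ell2.rep_eq ell2_apply_simps norm_shift_ell2)
  then show ?thesis
    by (auto simp: complex_bounded_linear_def intro!: ell2_eqI)
      (simp add: shift_ell2.rep_eq scaleC_ell2.rep_eq)
qed

lemma complex_bounded_linear_mult_op:
  assumes "bounded (range V)"
  shows "complex_bounded_linear (mult_op V)"
  using bounded_linear_mult_op[OF assms]
  by (auto simp: complex_bounded_linear_def mult_op_apply[OF assms] scaleC_ell2.rep_eq intro!: ell2_eqI)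

lemma bounded_rangeI_abs: "(\<And>n. \<bar>V n\<bar> \<le> (B::real)) \<Longrightarrow> bounded (range V)"
  by (auto simp: bounded_iff)

lemma norm_mult_op_le:
  assumes "\<And>n. \<bar>V n\<bar> \<le> B"
  shows "norm (mult_op V \<psi>) \<le> B * norm \<psi>"
proof (rule norm_ell2_leI)
  have B0: "0 \<le> B" using assms[of undefined] by linarith
  then show "0 \<le> B * norm \<psi>" by simp
  fix F :: "'a set" assume F: "finite F"
  have "(\<Sum>n\<in>F. (cmod (ell2_apply (mult_op V \<psi>) n))\<^sup>2) \<le> (\<Sum>n\<in>F. B\<^sup>2 * (cmod (ell2_apply \<psi> n))\<^sup>2)"
    by (rule sum_mono)
      (simp add: mult_op_apply[OF bounded_rangeI_abs[OF assms]] norm_mult power_mult_distrib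
        mult_right_mono power2_le_iff_abs_le assms B0)
  also have "\<dots> \<le> (B * norm \<psi>)\<^sup>2"
    using finite_sum_le_norm_ell2[OF F, of \<psi>]
    by (simp add: mult_left_mono power_mult_distrib flip: sum_distrib_left)
  finally show "(\<Sum>n\<in>F. (cmod (ell2_apply (mult_op V \<psi>) n))\<^sup>2) \<le> (B * norm \<psi>)\<^sup>2" .
qed

lemma inner_mult_op:
  assumes "bounded (range V)"
  shows "inner (mult_op V \<psi>) \<phi> = inner \<psi> (mult_op V \<phi>)"
  unfolding inner_ell2_Re
  by (intro arg_cong[where f = Re] infsum_cong) (simp add: mult_op_apply[OF assms])

text \<open>A symmetric complex-linear operator has a real quadratic form, so inserting
  \<open>\<i>\<close> makes it purely imaginary. This removes the diagonal part from the energy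
  estimate.\<close>

lemma inner_symmetric_ii_eq_0:
  assumes "\<And>\<psi> \<phi>. inner (T \<psi>) \<phi> = inner \<psi> (T \<phi>)" "complex_bounded_linear T"
  shows "inner \<psi> (\<i> *\<^sub>C T \<psi>) = 0"
proof -
  have "inner \<psi> (\<i> *\<^sub>C T \<psi>) = inner (T \<psi>) (\<i> *\<^sub>C \<psi>)"
    using assms(1)[of \<psi> "\<i> *\<^sub>C \<psi>"] complex_bounded_linearD(2)[OF assms(2)] by simp
  also have "\<dots> = - inner \<psi> (\<i> *\<^sub>C T \<psi>)"
    using inner_scaleC_ii_left[of \<psi> "T \<psi>"] by (simp add: inner_commute)
  finally show ?thesis by simp
qed

text \<open>One family covers both \<open>schroedinger_op\<close> (all weights 1) and its conjugates
  by exponential weights, which are no longer symmetric.\<close>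

definition weighted_op :: "(int ^ 'd \<Rightarrow> real) \<Rightarrow> real \<Rightarrow> (int ^ 'd \<Rightarrow> real) \<Rightarrow> (int ^ 'd) ell2 \<Rightarrow> (int ^ 'd) ell2" where
  "weighted_op w \<mu> V \<psi> = (\<Sum>e | l1_norm e = 1. w e *\<^sub>R shift_ell2 e \<psi>) + \<mu> *\<^sub>R mult_op V \<psi>"

lemma schroedinger_op_eq_weighted_op: "schroedinger_op \<mu> V = weighted_op (\<lambda>_. 1) \<mu> V"
  by (simp add: fun_eq_iff schroedinger_op_def weighted_op_def lattice_laplacian_eq_shifts)

lemma complex_bounded_linear_weighted_op:
  assumes "bounded (range V)"
  shows "complex_bounded_linear (weighted_op w \<mu> V)"
  unfolding weighted_op_def[abs_def]
  by (intro complex_bounded_linear_add complex_bounded_linear_sum complex_bounded_linear_scaleR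
      complex_bounded_linear_shift complex_bounded_linear_mult_op assms)

lemma weighted_op_apply:
  assumes "bounded (range V)"
  shows "ell2_apply (weighted_op w \<mu> V \<psi>) n =
    (\<Sum>e | l1_norm e = 1. of_real (w e) * ell2_apply \<psi> (n - e)) + of_real (\<mu> * V n) * ell2_apply \<psi> n"
  by (simp add: weighted_op_def ell2_apply_simps ell2_apply_sum shift_ell2.rep_eq mult_op_apply[OF assms])

section \<open>Conjugation by exponential weights\<close>

definition pairing :: "real ^ 'd \<Rightarrow> int ^ 'd \<Rightarrow> real" where
  "pairing \<rho> n = (\<Sum>i\<in>UNIV. \<rho> $ i * of_int (n $ i))"

lemma pairing_add: "pairing \<rho> (n + m) = pairing \<rho> n + pairing \<rho> m"
  by (simp add: pairing_def algebra_simps sum.distrib)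

lemma abs_pairing_le:
  assumes "\<And>i. \<bar>\<rho> $ i\<bar> \<le> r"
  shows "\<bar>pairing \<rho> n\<bar> \<le> r * of_int (l1_norm n)"
proof -
  have "\<bar>pairing \<rho> n\<bar> \<le> (\<Sum>i\<in>UNIV. \<bar>\<rho> $ i * of_int (n $ i)\<bar>)"
    unfolding pairing_def by (rule sum_abs)
  also have "\<dots> \<le> (\<Sum>i\<in>UNIV. r * of_int \<bar>n $ i\<bar>)"
    by (intro sum_mono) (simp add: abs_mult mult_right_mono assms)
  finally show ?thesis by (simp add: l1_norm_def sum_distrib_left)
qed

text \<open>The weight is an unbounded multiplier, so the conjugation is carried out on matrix
  entries of powers: along each path the hopping weights multiply to the exponential of the total
  displacement.\<close>

lemma weighted_op_conjugation:
  assumes "bounded (range V)"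
  shows "ell2_apply ((weighted_op (\<lambda>e. exp (pairing \<rho> e)) \<mu> V ^^ k) (delta m)) n =
    of_real (exp (pairing \<rho> (n - m))) * ell2_apply ((schroedinger_op \<mu> V ^^ k) (delta m)) n"
proof (induction k arbitrary: n)
  case 0
  have "pairing \<rho> 0 = 0" by (simp add: pairing_def)
  then show ?case by (simp add: delta.rep_eq)
next
  case (Suc k)
  let ?a = "\<lambda>n. ell2_apply ((schroedinger_op \<mu> V ^^ k) (delta m)) n"
  have *: "complex_of_real (exp (pairing \<rho> e)) * (of_real (exp (pairing \<rho> (n - e - m))) * ?a (n - e))
      = of_real (exp (pairing \<rho> (n - m))) * (of_real 1 * ?a (n - e))" for e
    using pairing_add[of \<rho> e "n - e - m"] by (simp flip: exp_add of_real_mult mult.assoc)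
  show ?case
    unfolding funpow.simps o_apply weighted_op_apply[OF assms] Suc
    unfolding *
    unfolding schroedinger_op_eq_weighted_op weighted_op_apply[OF assms] distrib_left sum_distrib_left
    by (simp add: mult_ac)
qed

lemma unitary_group_conjugation:
  assumes "bounded (range V)"
  shows "ell2_apply (unitary_group (weighted_op (\<lambda>e. exp (pairing \<rho> e)) \<mu> V) t (delta m)) n =
    of_real (exp (pairing \<rho> (n - m))) * ell2_apply (unitary_group (schroedinger_op \<mu> V) t (delta m)) n"
proof -
  note g = geometric_growth_funpow[OF complex_bounded_linearD(1)[OF complex_bounded_linear_weighted_op[OF assms]]]
  have s: "summable (\<lambda>k. (- \<i> * complex_of_real t) ^ k / fact k *
      ell2_apply ((schroedinger_op \<mu> V ^^ k) (delta m)) n)"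
    using bounded_linear.summable[OF bounded_linear_ell2_apply exp_series_summable[OF g]]
    by (simp add: scaleC_ell2.rep_eq schroedinger_op_eq_weighted_op)
  show ?thesis
    unfolding unitary_group_eq ell2_apply_exp_series[OF g] weighted_op_conjugation[OF assms]
    using suminf_mult[OF s, of "of_real (exp (pairing \<rho> (n - m)))"]
      ell2_apply_exp_series[OF g, of "\<lambda>_. 1" \<mu> "delta m" t n]
    by (simp add: schroedinger_op_eq_weighted_op mult_ac)
qed

text \<open>A matrix of finite range written by diagonals: row n has the entry \<open>a n e\<close>
  in column n - e.\<close>

definition band_op :: "(int ^ 'd) set \<Rightarrow> (int ^ 'd \<Rightarrow> int ^ 'd \<Rightarrow> real) \<Rightarrow> (int ^ 'd) ell2 \<Rightarrow> (int ^ 'd) ell2" where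
  "band_op F a \<psi> = (\<Sum>e\<in>F. mult_op (\<lambda>n. a n e) (shift_ell2 e \<psi>))"

lemma complex_bounded_linear_band_op:
  assumes "\<And>n e. e \<in> F \<Longrightarrow> \<bar>a n e\<bar> \<le> M"
  shows "complex_bounded_linear (band_op F a)"
  unfolding band_op_def[abs_def]
  by (rule complex_bounded_linear_sum, rule complex_bounded_linear_compose[OF
      complex_bounded_linear_mult_op[OF bounded_rangeI_abs[OF assms]] complex_bounded_linear_shift])

lemma band_op_apply:
  assumes "\<And>n e. e \<in> F \<Longrightarrow> \<bar>a n e\<bar> \<le> M"
  shows "ell2_apply (band_op F a \<psi>) n = (\<Sum>e\<in>F. of_real (a n e) * ell2_apply \<psi> (n - e))"
  unfolding band_op_def ell2_apply_sum
  by (rule sum.cong) (simp_all add: mult_op_apply[OF bounded_rangeI_abs[OF assms]] shift_ell2.rep_eq)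

lemma norm_band_op_le:
  assumes "\<And>n e. e \<in> F \<Longrightarrow> \<bar>a n e\<bar> \<le> M"
  shows "norm (band_op F a \<psi>) \<le> real (card F) * M * norm \<psi>"
proof -
  have "norm (band_op F a \<psi>) \<le> (\<Sum>e\<in>F. norm (mult_op (\<lambda>n. a n e) (shift_ell2 e \<psi>)))"
    unfolding band_op_def by (rule norm_sum)
  also have "\<dots> \<le> (\<Sum>e\<in>F. M * norm \<psi>)"
    by (intro sum_mono order_trans[OF norm_mult_op_le[OF assms]]) (auto simp: norm_shift_ell2)
  finally show ?thesis by simp
qed

text \<open>With y the evolution and z = S y, the intertwining relation gives z' = -i (D z + R y).
  The part D does not change the norm of z, and the norm of y is at most twice that of z, so
  Gronwall applies to z.\<close>

lemma norm_unitary_group_le_of_intertwining: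
  fixes H S D R :: "'a ell2 \<Rightarrow> 'a ell2"
  assumes H: "complex_bounded_linear H" and S: "complex_bounded_linear S"
    and D: "\<And>\<psi>. inner \<psi> (\<i> *\<^sub>C D \<psi>) = 0"
    and SH: "\<And>\<psi>. S (H \<psi>) = D (S \<psi>) + R \<psi>"
    and R: "\<And>\<psi>. norm (R \<psi>) \<le> r * norm \<psi>" and r: "0 \<le> r"
    and S1: "\<And>\<psi>. norm (S \<psi> - \<psi>) \<le> norm \<psi> / 2" and t: "0 \<le> t"
  shows "norm (unitary_group H t \<psi>) \<le> 3 * exp (2 * r * t) * norm \<psi>"
proof -
  define y where "y = (\<lambda>t. unitary_group H t \<psi>)"
  define z where "z = (\<lambda>t. S (y t))"
  have y': "(y has_vector_derivative - (\<i> *\<^sub>C H (y t))) (at t)" for t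
    unfolding y_def by (rule unitary_group_has_vector_derivative[OF H])
  have z': "(z has_vector_derivative - (\<i> *\<^sub>C (D (z t) + R (y t)))) (at t)" for t
    unfolding z_def SH[symmetric]
    using bounded_linear.has_vector_derivative[OF complex_bounded_linearD(1)[OF S] y', of t]
    by (simp add: complex_bounded_linearD(2)[OF S]
        linear_neg[OF bounded_linear.linear[OF complex_bounded_linearD(1)[OF S]]])
  have yz: "norm (y t) \<le> 2 * norm (z t)" for t
    using S1[of "y t"] norm_triangle_ineq2[of "y t" "z t"]
    by (simp add: z_def norm_minus_commute)
  \<comment> \<open>The rate 4 r is the product of r, a 2 from differentiating the square, and a 2
    from replacing y by z.\<close>
  define g where "g = (\<lambda>t. inner (z t) (z t) * exp (- 4 * r * t))"
  have "\<exists>g'. (g has_real_derivative g') (at x) \<and> g' \<le> 0" for x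
  proof -
    define u where "u = \<i> *\<^sub>C (D (z x) + R (y x))"
    have g': "(g has_real_derivative (inner (z x) (- u) + inner (- u) (z x)) * exp (- 4 * r * x)
        + - 4 * r * exp (- 4 * r * x) * inner (z x) (z x)) (at x)"
      unfolding g_def u_def
      by (rule derivative_eq_intros has_real_derivative_inner z' refl | simp)+
    have "- inner (z x) u \<le> 2 * r * inner (z x) (z x)"
    proof -
      have "- inner (z x) u = - inner (z x) (\<i> *\<^sub>C R (y x))"
        by (simp add: u_def scaleC_add inner_add_right D)
      also have "\<dots> \<le> norm (z x) * norm (\<i> *\<^sub>C R (y x))"
        using Cauchy_Schwarz_ineq2[of "z x" "\<i> *\<^sub>C R (y x)"] by linarith
      also have "\<dots> \<le> norm (z x) * (r * (2 * norm (z x)))"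
        using R[of "y x"] mult_left_mono[OF yz r, of x] by (intro mult_left_mono) (auto simp: norm_scaleC_ell2)
      finally show ?thesis by (simp add: dot_square_norm power2_eq_square mult_ac)
    qed
    then have "(- 2 * inner (z x) u - 4 * r * inner (z x) (z x)) * exp (- 4 * r * x) \<le> 0"
      by (intro mult_nonpos_nonneg) auto
    then have "(inner (z x) (- u) + inner (- u) (z x)) * exp (- 4 * r * x)
        + - 4 * r * exp (- 4 * r * x) * inner (z x) (z x) \<le> 0"
      by (simp add: inner_commute[of u "z x"] algebra_simps)
    with g' show ?thesis by blast
  qed
  then have "g t \<le> g 0" by (intro DERIV_nonpos_imp_nonincreasing[OF t]) blast
  then have "(norm (z t))\<^sup>2 * exp (- 4 * r * t) \<le> (norm (z 0))\<^sup>2"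
    by (simp add: g_def dot_square_norm)
  then have "(norm (z t))\<^sup>2 \<le> (norm (z 0))\<^sup>2 * exp (4 * r * t)"
    by (simp add: exp_minus field_simps)
  also have "\<dots> = (norm (z 0) * exp (2 * r * t))\<^sup>2"
    using exp_double[of "2 * r * t"] by (simp add: power_mult_distrib mult.assoc)
  finally have zt: "norm (z t) \<le> norm (z 0) * exp (2 * r * t)"
    by (rule power2_le_imp_le) simp
  have y0: "y 0 = \<psi>" by (simp add: y_def unitary_group_eq exp_series_0)
  have "norm (z 0) \<le> 3 / 2 * norm \<psi>"
    using S1[of \<psi>] norm_triangle_ineq2[of "S \<psi>" \<psi>] by (simp add: z_def y0)
  then have "norm (z 0) * exp (2 * r * t) \<le> 3 / 2 * norm \<psi> * exp (2 * r * t)"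
    by (intro mult_right_mono) auto
  \<comment> \<open>The final factor 3 is 2, for returning from z to y, times 3/2, for the initial
    value of z.\<close>
  with yz[of t] zt have "norm (y t) \<le> 2 * (3 / 2 * norm \<psi> * exp (2 * r * t))" by linarith
  then show ?thesis by (simp add: y_def mult_ac)
qed

section \<open>Approximate left eigenvectors and the upper bound\<close>

text \<open>The hopping part of \<open>weighted_op\<close> acting from the right on a row s, in
  displacement coordinates.\<close>

definition hop_sum :: "(int ^ 'd \<Rightarrow> real) \<Rightarrow> (int ^ 'd \<Rightarrow> real) \<Rightarrow> int ^ 'd \<Rightarrow> real" where
  "hop_sum w s e = (\<Sum>f | l1_norm f = 1. w f * s (e - f))"

lemma hop_sum_le:
  assumes "\<And>f. 0 \<le> w f" "(\<Sum>f | l1_norm f = 1. w f) \<le> A" "\<And>e. \<bar>s e\<bar> \<le> \<delta>"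
  shows "\<bar>hop_sum w s x\<bar> \<le> A * \<delta>"
proof -
  have d: "0 \<le> \<delta>" using assms(3)[of 0] by linarith
  have "\<bar>hop_sum w s x\<bar> \<le> (\<Sum>f | l1_norm f = 1. \<bar>w f * s (x - f)\<bar>)"
    unfolding hop_sum_def by (rule sum_abs)
  also have "\<dots> \<le> (\<Sum>f | l1_norm f = 1. w f * \<delta>)"
    by (intro sum_mono) (simp add: abs_mult assms mult_left_mono)
  also have "\<dots> \<le> A * \<delta>" using assms(2) d by (simp add: mult_right_mono flip: sum_distrib_right)
  finally show ?thesis .
qed

lemma hop_sum_diff: "hop_sum w (\<lambda>e. s e - s' e) e = hop_sum w s e - hop_sum w s' e"
  by (simp add: hop_sum_def right_diff_distrib sum_subtractf)

text \<open>Fixed-point iteration for the left eigenvector at the site \<open>n\<close>, normalised to be \<open>1\<close> at \<open>n\<close>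
  itself. It is indexed by displacements, so that the site paired with \<open>e\<close> is \<open>n - e\<close>. When the
  denominator vanishes, Isabelle's division returns \<open>0\<close>; this is harmless because the \<open>k\<close>-th
  iterate is supported in \<open>l1_norm e < k\<close>.\<close>

primrec eigen_row :: "(int ^ 'd \<Rightarrow> real) \<Rightarrow> real \<Rightarrow> (int ^ 'd \<Rightarrow> real) \<Rightarrow> int ^ 'd \<Rightarrow> nat \<Rightarrow> int ^ 'd \<Rightarrow> real" where
  "eigen_row w \<mu> V n 0 = (\<lambda>e. 0)"
| "eigen_row w \<mu> V n (Suc k) = (\<lambda>e. if e = 0 then 1 else
     hop_sum w (eigen_row w \<mu> V n k) e /
       (\<mu> * V n + hop_sum w (eigen_row w \<mu> V n k) 0 - \<mu> * V (n - e)))"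

text \<open>The iteration starts from 0 and each round spreads the row by one site. The P-th iterate
  therefore sees only displacements shorter than P, where the gap assumption holds.\<close>

lemma eigen_row_support:
  assumes "int k \<le> l1_norm e"
  shows "eigen_row w \<mu> V n k e = 0"
  using assms
proof (induction k arbitrary: e)
  case (Suc k)
  have "e \<noteq> 0" using Suc.prems by auto
  moreover have "eigen_row w \<mu> V n k (e - f) = 0" if "l1_norm f = 1" for f
    using Suc l1_norm_triangle_diff[of e f] that by (intro Suc.IH) auto
  then have "hop_sum w (eigen_row w \<mu> V n k) e = 0"
    unfolding hop_sum_def by (intro sum.neutral) auto
  ultimately show ?case by simp
qed simp

context
  fixes w :: "int ^ 'd \<Rightarrow> real" and \<mu> A \<sigma> :: real and V :: "int ^ 'd \<Rightarrow> real" and n :: "int ^ 'd" and P :: nat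
  assumes w: "\<And>f. 0 \<le> w f" "(\<Sum>f | l1_norm f = 1. w f) \<le> A"
    and \<sigma>: "0 < \<sigma>"
    and gap: "\<And>e. e \<noteq> 0 \<Longrightarrow> l1_norm e < int P \<Longrightarrow> \<sigma> \<le> \<bar>V n - V (n - e)\<bar>"
    and \<mu>: "0 < \<mu>" "2 * A \<le> \<mu> * \<sigma>"
begin

lemma A_nonneg: "0 \<le> A"
  using sum_nonneg[of "{f. l1_norm f = 1}" w] w by force

text \<open>The shift E of the eigenvalue is at most A, that is, at most half of the potential gap
  \<open>\<mu> * \<sigma>\<close>.\<close>

lemma denominator_ge:
  assumes "e \<noteq> 0" "l1_norm e < int P" "\<bar>E\<bar> \<le> A"
  shows "\<mu> * \<sigma> / 2 \<le> \<bar>\<mu> * V n + E - \<mu> * V (n - e)\<bar>"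
proof -
  have "\<mu> * \<sigma> \<le> \<bar>\<mu> * (V n - V (n - e))\<bar>"
    using gap[OF assms(1,2)] \<mu> by (simp add: abs_mult)
  moreover have "\<mu> * V n + E - \<mu> * V (n - e) = \<mu> * (V n - V (n - e)) + E"
    by (simp add: algebra_simps)
  ultimately show ?thesis using assms(3) \<mu> by linarith
qed

text \<open>The numerator is at most A and the denominator at least
  \<open>\<mu> * \<sigma> / 2\<close>; outside the support there is nothing to prove. This smallness
  later makes S close to the identity.\<close>

lemma eigen_row_off_diagonal:
  assumes "\<And>e. \<bar>eigen_row w \<mu> V n k e\<bar> \<le> 1" "Suc k \<le> P" "e \<noteq> 0"
  shows "\<bar>eigen_row w \<mu> V n (Suc k) e\<bar> \<le> 2 * A / (\<mu> * \<sigma>)"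
proof (cases "l1_norm e < int (Suc k)")
  case True
  have h: "\<bar>hop_sum w (eigen_row w \<mu> V n k) x\<bar> \<le> A" for x
    using hop_sum_le[of w A "eigen_row w \<mu> V n k" 1 x] w assms(1) by simp
  have "\<mu> * \<sigma> / 2 \<le> \<bar>\<mu> * V n + hop_sum w (eigen_row w \<mu> V n k) 0 - \<mu> * V (n - e)\<bar>"
    using True assms by (intro denominator_ge h) auto
  then have "\<bar>hop_sum w (eigen_row w \<mu> V n k) e\<bar> /
      \<bar>\<mu> * V n + hop_sum w (eigen_row w \<mu> V n k) 0 - \<mu> * V (n - e)\<bar> \<le> A / (\<mu> * \<sigma> / 2)"
    using h[of e] \<mu> \<sigma> A_nonneg by (intro frac_le) simp_all
  then show ?thesis using assms(3) by (simp add: mult.commute)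
next
  case False
  then show ?thesis using eigen_row_support[of "Suc k" e w \<mu> V n] A_nonneg \<mu> \<sigma> by (simp del: eigen_row.simps)
qed

lemma eigen_row_le_1:
  assumes "k \<le> P"
  shows "\<bar>eigen_row w \<mu> V n k e\<bar> \<le> 1"
  using assms
proof (induction k arbitrary: e)
  case (Suc k)
  show ?case
  proof (cases "e = 0")
    case False
    have "2 * A / (\<mu> * \<sigma>) \<le> 1" using \<mu> \<sigma> by simp
    moreover have "\<bar>eigen_row w \<mu> V n (Suc k) e\<bar> \<le> 2 * A / (\<mu> * \<sigma>)"
      using Suc False by (intro eigen_row_off_diagonal) auto
    ultimately show ?thesis by linarith
  qed simp
qed simp

text \<open>The iteration contracts: if two successive iterates differ by at most \<delta>,
  numerator and denominator each change by at most \<open>A * \<delta>\<close>, and division by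
  \<open>\<mu> * \<sigma> / 2\<close> yields the ratio
  \<open>4 * A / (\<mu> * \<sigma>)\<close>.\<close>

lemma eigen_row_diff_le:
  assumes "Suc k \<le> P"
  shows "\<bar>eigen_row w \<mu> V n (Suc k) e - eigen_row w \<mu> V n k e\<bar> \<le> (4 * A / (\<mu> * \<sigma>)) ^ k"
  using assms
proof (induction k arbitrary: e)
  case 0
  show ?case by (simp add: hop_sum_def)
next
  case (Suc k)
  define \<delta> where "\<delta> = (4 * A / (\<mu> * \<sigma>)) ^ k"
  have \<delta>0: "0 \<le> \<delta>" using A_nonneg \<mu> \<sigma> by (simp add: \<delta>_def)
  let ?s = "eigen_row w \<mu> V n"
  show ?case
  \<comment> \<open>In the first case the two iterates agree: both are 1 at the origin, and both
    vanish beyond the larger support.\<close>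
  proof (cases "e = 0 \<or> int (Suc (Suc k)) \<le> l1_norm e")
    case True
    then show ?thesis
      using eigen_row_support[of "Suc (Suc k)" e w \<mu> V n] eigen_row_support[of "Suc k" e w \<mu> V n]
        A_nonneg \<mu> \<sigma> by (auto simp del: eigen_row.simps(2)) (auto)
  next
    case False
    define a b a' b' where
      "a = hop_sum w (?s (Suc k)) e" and "b = \<mu> * V n + hop_sum w (?s (Suc k)) 0 - \<mu> * V (n - e)" and
      "a' = hop_sum w (?s k) e" and "b' = \<mu> * V n + hop_sum w (?s k) 0 - \<mu> * V (n - e)"
    have d: "\<bar>hop_sum w (?s (Suc k)) e - hop_sum w (?s k) e\<bar> \<le> A * \<delta>" for e
      unfolding hop_sum_diff[symmetric] using Suc.prems
      by (intro hop_sum_le w Suc.IH[folded \<delta>_def]) auto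
    have eE: "e \<noteq> 0" "l1_norm e < int P" using False Suc.prems by auto
    have h: "\<bar>hop_sum w (?s j) 0\<bar> \<le> A" if "j \<le> P" for j
      using hop_sum_le[of w A "?s j" 1 0] w eigen_row_le_1[OF that] by simp
    have b: "\<mu> * \<sigma> / 2 \<le> \<bar>b\<bar>" "\<mu> * \<sigma> / 2 \<le> \<bar>b'\<bar>"
      unfolding b_def b'_def using Suc.prems by (intro denominator_ge eE h; simp)+
    have pos: "0 < \<mu> * \<sigma> / 2" using \<mu> \<sigma> by simp
    then have bn: "b \<noteq> 0" "b' \<noteq> 0" using b by auto
    have s: "?s (Suc (Suc k)) e = a / b" "?s (Suc k) e = a' / b'"
      using eE by (simp_all add: a_def b_def a'_def b'_def)
    have s1: "\<bar>a' / b'\<bar> \<le> 1" using eigen_row_le_1[of "Suc k" e] Suc.prems s by simp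
    \<comment> \<open>This form charges the change of the denominator to \<open>a' / b'\<close>, an
      entry of an iterate and hence at most 1, leaving a single division by b.\<close>
    have "a / b - a' / b' = ((a - a') + (a' / b') * (b' - b)) / b"
      using bn by (simp add: field_simps)
    also have "\<bar>\<dots>\<bar> \<le> (2 * A * \<delta>) / (\<mu> * \<sigma> / 2)"
      unfolding abs_divide
    proof (rule frac_le)
      have "\<bar>(a' / b') * (b' - b)\<bar> \<le> 1 * (A * \<delta>)"
        unfolding abs_mult using s1 d[of 0] by (intro mult_mono) (auto simp: b_def b'_def)
      moreover have "\<bar>a - a'\<bar> \<le> A * \<delta>" using d[of e] by (simp add: a_def a'_def)
      ultimately show "\<bar>a - a' + a' / b' * (b' - b)\<bar> \<le> 2 * A * \<delta>"
        using abs_triangle_ineq[of "a - a'" "a' / b' * (b' - b)"] by linarith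
    qed (use pos b A_nonneg \<delta>0 in auto)
    finally show ?thesis unfolding s by (simp add: \<delta>_def mult_ac)
  qed
qed

end

text \<open>The P-th iterates at all sites are the rows of S, and their approximate eigenvalues form
  D. The fixed-point equation fails only by the hopping sum of the last increment, which is of order
  \<open>\<mu>\<close> to the power 1 - P.\<close>

lemma eigen_row_intertwining:
  fixes V :: "int ^ 'd \<Rightarrow> real" and A \<sigma> \<mu> :: real
  assumes V: "bounded (range V)" and w: "\<And>f. 0 \<le> w f" "(\<Sum>f | l1_norm f = 1. w f) \<le> A"
    and \<sigma>: "0 < \<sigma>" and P: "0 < P"
    and gap: "\<And>n e. e \<noteq> 0 \<Longrightarrow> l1_norm e < int P \<Longrightarrow> \<sigma> \<le> \<bar>V n - V (n - e)\<bar>"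
    and \<mu>: "0 < \<mu>" "2 * A \<le> \<mu> * \<sigma>" "4 * A * card {e :: int ^ 'd. l1_norm e < int P} \<le> \<mu> * \<sigma>"
    and t: "0 \<le> t"
  shows "norm (unitary_group (weighted_op w \<mu> V) t \<psi>) \<le>
    3 * exp (2 * (card {e :: int ^ 'd. l1_norm e < int (Suc P)} * (A * (4 * A / (\<mu> * \<sigma>)) ^ (P - 1))) * t) * norm \<psi>"
proof -
  define s where "s = (\<lambda>n. eigen_row w \<mu> V n P)"
  define s' where "s' = (\<lambda>n. eigen_row w \<mu> V n (P - 1))"
  have P': "P = Suc (P - 1)" using P by simp
  note rules = eigen_row_le_1[where A = A and \<sigma> = \<sigma> and P = P]
    eigen_row_diff_le[where A = A and \<sigma> = \<sigma> and P = P]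
    eigen_row_off_diagonal[where A = A and \<sigma> = \<sigma> and P = P]
    denominator_ge[where w = w and A = A and P = P]
  \<comment> \<open>The eigenvalue uses the penultimate iterate, so that E n occurs exactly in the
    denominators defining the last iterate s.\<close>
  define E where "E = (\<lambda>n. \<mu> * V n + hop_sum w (s' n) 0)"
  have s1: "\<bar>s n e\<bar> \<le> 1" "\<bar>s' n e\<bar> \<le> 1" for n e
    unfolding s_def s'_def by (rule rules(1); use w \<sigma> gap \<mu> in simp)+
  have A0: "0 \<le> A" using order_trans[OF sum_nonneg w(2)] w(1) by blast
  define F where "F = {e :: int ^ 'd. l1_norm e < int P}"
  \<comment> \<open>A hop may lead one site out of F, so the residual needs the next larger
    ball.\<close>
  define F' where "F' = {e :: int ^ 'd. l1_norm e < int (Suc P)}"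
  have fin: "finite F" "finite F'" unfolding F_def F'_def by (rule finite_l1_ball)+
  have FF': "F \<subseteq> F'" by (auto simp: F_def F'_def)
  have supp: "s n e = 0" if "e \<notin> F" for n e
    using that eigen_row_support unfolding s_def F_def by (metis mem_Collect_eq not_le)
  define r where "r = (\<lambda>n e. hop_sum w (\<lambda>e. s n e - s' n e) e)"
  have rbound: "\<bar>r n e\<bar> \<le> A * (4 * A / (\<mu> * \<sigma>)) ^ (P - 1)" for n e
    unfolding r_def s_def s'_def
  proof (intro hop_sum_le w)
    fix e
    have "\<bar>eigen_row w \<mu> V n (Suc (P - 1)) e - eigen_row w \<mu> V n (P - 1) e\<bar> \<le> (4 * A / (\<mu> * \<sigma>)) ^ (P - 1)"
      by (rule rules(2)) (use w \<sigma> gap \<mu> P in simp_all)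
    then show "\<bar>eigen_row w \<mu> V n P e - eigen_row w \<mu> V n (P - 1) e\<bar> \<le> (4 * A / (\<mu> * \<sigma>)) ^ (P - 1)"
      using P by simp
  qed
  have residual: "s n e * (\<mu> * V (n - e)) + hop_sum w (s n) e = E n * s n e + r n e" for n e
  proof -
    have r: "r n e = hop_sum w (s n) e - hop_sum w (s' n) e" by (simp add: r_def hop_sum_diff)
    have s: "s n e = (if e = 0 then 1 else hop_sum w (s' n) e / (E n - \<mu> * V (n - e)))"
      unfolding s_def s'_def E_def by (subst P', subst eigen_row.simps(2)) (rule refl)
    consider "e = 0" | "e \<noteq> 0" "e \<in> F" | "e \<noteq> 0" "e \<notin> F" by blast
    then show ?thesis
    proof cases
      case 1
      then show ?thesis using s r by (simp add: E_def)
    next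
      case 2
      have "\<bar>hop_sum w (s' n) 0\<bar> \<le> A" using hop_sum_le[of w A "s' n" 1 0] w s1(2) by simp
      then have "\<mu> * \<sigma> / 2 \<le> \<bar>E n - \<mu> * V (n - e)\<bar>"
        unfolding E_def by (intro rules(4)) (use 2 w \<sigma> gap \<mu> in \<open>auto simp: F_def\<close>)
      moreover have "0 < \<mu> * \<sigma>" using \<mu> \<sigma> by simp
      ultimately have "E n - \<mu> * V (n - e) \<noteq> 0" by auto
      then have "s n e * (E n - \<mu> * V (n - e)) = hop_sum w (s' n) e" using s 2 by simp
      then show ?thesis unfolding r by (simp add: algebra_simps)
    next
      case 3
      \<comment> \<open>Here e has norm at least P, so e - f has norm at least P - 1, which is
        already outside the support of the iterate number P - 1.\<close>
      have "s' n (e - f) = 0" if "l1_norm f = 1" for f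
        unfolding s'_def using 3(2) that P l1_norm_triangle_diff[of e f]
        by (intro eigen_row_support) (auto simp: F_def)
      then have "hop_sum w (s' n) e = 0" unfolding hop_sum_def by (intro sum.neutral) auto
      then show ?thesis using supp[OF 3(2)] by (simp add: r)
    qed
  qed
  define S where "S = band_op F s"
  define R where "R = band_op F' r"
  define D where "D = mult_op E"
  obtain B where B: "\<And>n. \<bar>V n\<bar> \<le> B" using V by (auto simp: bounded_iff)
  have E: "bounded (range E)"
  proof (rule bounded_rangeI_abs)
    fix n
    have "\<bar>E n\<bar> \<le> \<mu> * \<bar>V n\<bar> + \<bar>hop_sum w (s' n) 0\<bar>"
      using \<mu>(1) unfolding E_def by (metis abs_mult abs_of_pos abs_triangle_ineq)
    also have "\<dots> \<le> \<mu> * B + A * 1"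
      by (intro add_mono mult_left_mono B hop_sum_le w s1) (use \<mu> in auto)
    finally show "\<bar>E n\<bar> \<le> \<mu> * B + A * 1" .
  qed
  have "norm (unitary_group (weighted_op w \<mu> V) t \<psi>)
      \<le> 3 * exp (2 * (card F' * (A * (4 * A / (\<mu> * \<sigma>)) ^ (P - 1))) * t) * norm \<psi>"
  proof (rule norm_unitary_group_le_of_intertwining[OF complex_bounded_linear_weighted_op[OF V]])
    show "complex_bounded_linear S" unfolding S_def by (rule complex_bounded_linear_band_op[OF s1(1)])
    show "inner \<phi> (\<i> *\<^sub>C D \<phi>) = 0" for \<phi>
      unfolding D_def by (rule inner_symmetric_ii_eq_0[OF inner_mult_op[OF E] complex_bounded_linear_mult_op[OF E]])
    show "norm (R \<phi>) \<le> card F' * (A * (4 * A / (\<mu> * \<sigma>)) ^ (P - 1)) * norm \<phi>" for \<phi>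
      unfolding R_def by (rule norm_band_op_le[OF rbound])
    show "0 \<le> card F' * (A * (4 * A / (\<mu> * \<sigma>)) ^ (P - 1))" using A0 \<mu> \<sigma> by simp
    show "norm (S \<phi> - \<phi>) \<le> norm \<phi> / 2" for \<phi>
    proof -
      \<comment> \<open>S has ones on its diagonal, so S - 1 is the band operator of its
        off-diagonal entries.\<close>
      define a where "a = (\<lambda>n e. if e = 0 then 0 else s n e)"
      have a: "\<bar>a n e\<bar> \<le> 2 * A / (\<mu> * \<sigma>)" for n e
      proof (cases "e = 0")
        case False
        have "\<bar>eigen_row w \<mu> V n (Suc (P - 1)) e\<bar> \<le> 2 * A / (\<mu> * \<sigma>)"
          by (rule rules(3)) (use False w \<sigma> gap \<mu> P s1(2) in \<open>simp_all add: s'_def\<close>)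
        then show ?thesis using False P by (simp add: a_def s_def)
      qed (use A0 \<mu> \<sigma> in \<open>simp add: a_def\<close>)
      have s0: "s n 0 = 1" for n unfolding s_def by (subst P') simp
      have F0: "0 \<in> F" using P by (simp add: F_def)
      have "S \<phi> - \<phi> = band_op F a \<phi>"
      proof (rule ell2_eqI)
        fix n
        have "ell2_apply (band_op F a \<phi>) n = (\<Sum>e\<in>F - {0}. of_real (s n e) * ell2_apply \<phi> (n - e))"
          unfolding band_op_apply[OF a] by (simp add: sum.remove[OF fin(1) F0] a_def)
        then show "ell2_apply (S \<phi> - \<phi>) n = ell2_apply (band_op F a \<phi>) n"
          by (simp add: S_def minus_ell2.rep_eq band_op_apply[OF s1(1)] sum.remove[OF fin(1) F0] s0)
      qed
      moreover have "norm (band_op F a \<phi>) \<le> card F * (2 * A / (\<mu> * \<sigma>)) * norm \<phi>"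
        by (rule norm_band_op_le[OF a])
      \<comment> \<open>This is the purpose of the assumption on \<mu> that involves the size of the
        ball.\<close>
      moreover have "card F * (2 * A / (\<mu> * \<sigma>)) \<le> 1 / 2"
        using \<mu> \<sigma> by (simp add: F_def field_simps)
      ultimately show ?thesis
        using mult_right_mono[of "card F * (2 * A / (\<mu> * \<sigma>))" "1 / 2" "norm \<phi>"] by simp
    qed
    show "S (weighted_op w \<mu> V \<phi>) = D (S \<phi>) + R \<phi>" for \<phi>
    proof (rule ell2_eqI)
      fix n
      let ?\<phi> = "ell2_apply \<phi>"
      \<comment> \<open>Moving the hop f from the vector to the row makes the range of summation F'
        independent of f, so that the sums over e and f can be exchanged.\<close>
      have reindex: "(\<Sum>e\<in>F. of_real (s n e) * ?\<phi> (n - e - f)) = (\<Sum>e\<in>F'. of_real (s n (e - f)) * ?\<phi> (n - e))"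
        if f: "l1_norm f = 1" for f
      proof -
        have "(\<Sum>e\<in>F. of_real (s n e) * ?\<phi> (n - e - f)) = (\<Sum>e\<in>(\<lambda>e. e + f) ` F. of_real (s n (e - f)) * ?\<phi> (n - e))"
          by (subst sum.reindex) (auto simp: inj_on_def algebra_simps)
        also have "\<dots> = (\<Sum>e\<in>F'. of_real (s n (e - f)) * ?\<phi> (n - e))"
        proof (rule sum.mono_neutral_left[OF fin(2)])
          show "(\<lambda>e. e + f) ` F \<subseteq> F'"
          proof
            fix x assume "x \<in> (\<lambda>e. e + f) ` F"
            then obtain e where "e \<in> F" "x = e + f" by blast
            then show "x \<in> F'" using l1_norm_triangle[of e f] f by (simp add: F_def F'_def)
          qed
          show "\<forall>e\<in>F' - (\<lambda>e. e + f) ` F. of_real (s n (e - f)) * ?\<phi> (n - e) = 0"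
          proof
            fix e assume "e \<in> F' - (\<lambda>e. e + f) ` F"
            then have "e - f \<notin> F" by (metis DiffD2 diff_add_cancel image_eqI)
            then show "of_real (s n (e - f)) * ?\<phi> (n - e) = 0" using supp by simp
          qed
        qed
        finally show ?thesis .
      qed
      have FF: "(\<Sum>e\<in>F. of_real (s n e) * g e) = (\<Sum>e\<in>F'. of_real (s n e) * g e)" for g :: "int ^ 'd \<Rightarrow> complex"
        by (rule sum.mono_neutral_left[OF fin(2) FF']) (use supp in auto)
      have "ell2_apply (S (weighted_op w \<mu> V \<phi>)) n =
          (\<Sum>f | l1_norm f = 1. of_real (w f) * (\<Sum>e\<in>F. of_real (s n e) * ?\<phi> (n - e - f)))
          + (\<Sum>e\<in>F. of_real (s n e) * (of_real (\<mu> * V (n - e)) * ?\<phi> (n - e)))"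
        unfolding S_def band_op_apply[OF s1(1)] weighted_op_apply[OF V] distrib_left sum.distrib
          sum_distrib_left
        by (subst sum.swap) (simp add: mult_ac)
      also have "(\<Sum>f | l1_norm f = 1. of_real (w f) * (\<Sum>e\<in>F. of_real (s n e) * ?\<phi> (n - e - f)))
          = (\<Sum>f | l1_norm f = 1. of_real (w f) * (\<Sum>e\<in>F'. of_real (s n (e - f)) * ?\<phi> (n - e)))"
        by (rule sum.cong) (simp_all add: reindex)
      also have "\<dots> = (\<Sum>e\<in>F'. of_real (hop_sum w (s n) e) * ?\<phi> (n - e))"
        unfolding hop_sum_def sum_distrib_left of_real_sum sum_distrib_right
        by (subst sum.swap) (simp add: mult_ac)
      also have "(\<Sum>e\<in>F'. of_real (hop_sum w (s n) e) * ?\<phi> (n - e))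
          + (\<Sum>e\<in>F. of_real (s n e) * (of_real (\<mu> * V (n - e)) * ?\<phi> (n - e)))
          = (\<Sum>e\<in>F'. of_real (s n e * (\<mu> * V (n - e)) + hop_sum w (s n) e) * ?\<phi> (n - e))"
        unfolding FF sum.distrib[symmetric] by (rule sum.cong) (simp_all add: algebra_simps)
      also have "\<dots> = of_real (E n) * (\<Sum>e\<in>F. of_real (s n e) * ?\<phi> (n - e))
          + (\<Sum>e\<in>F'. of_real (r n e) * ?\<phi> (n - e))"
        unfolding residual FF sum_distrib_left sum.distrib[symmetric]
        by (rule sum.cong) (simp_all add: algebra_simps)
      also have "\<dots> = ell2_apply (D (S \<phi>) + R \<phi>) n"
        by (simp add: D_def S_def R_def plus_ell2.rep_eq mult_op_apply[OF E] band_op_apply[OF s1(1)]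
            band_op_apply[OF rbound])
      finally show "ell2_apply (S (weighted_op w \<mu> V \<phi>)) n = ell2_apply (D (S \<phi>) + R \<phi>) n" .
    qed
  qed (fact t)
  then show ?thesis by (simp add: F'_def)
qed

lemma powi_one_minus:
  assumes "0 < P"
  shows "(\<mu>::real) powi (- int P + 1) = 1 / \<mu> ^ (P - 1)"
proof -
  have "- int P + 1 = - int (P - 1)" using assms by simp
  then show ?thesis by (simp only: power_int_minus power_int_of_nat inverse_eq_divide)
qed

section \<open>Periodicity and the potential gap\<close>

definition cell_rep :: "nat ^ 'd \<Rightarrow> int ^ 'd \<Rightarrow> int ^ 'd" where
  "cell_rep p n = (\<chi> i. n $ i mod int (p $ i))"

lemma cell_rep_in_cell:
  assumes "\<And>i. 1 \<le> p $ i"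
  shows "cell_rep p n \<in> fundamental_cell p"
proof -
  have "0 < int (p $ i)" for i using assms[of i] by linarith
  then show ?thesis by (simp add: cell_rep_def fundamental_cell_def)
qed

lemma cell_rep_eq_iff: "cell_rep p n = cell_rep p m \<longleftrightarrow> (\<forall>i. int (p $ i) dvd n $ i - m $ i)"
  by (simp add: cell_rep_def vec_eq_iff mod_eq_dvd_iff)

lemma periodic_eqI:
  assumes "periodic p V" "\<And>i. int (p $ i) dvd n $ i - m $ i"
  shows "V n = V m"
proof -
  have "V (m + (n - m)) = V m" using assms unfolding periodic_def by (metis vector_minus_component)
  then show ?thesis by simp
qed

lemma periodic_cell_rep:
  assumes "periodic p V"
  shows "V (cell_rep p n) = V n"
  by (rule periodic_eqI[OF assms]) (simp add: cell_rep_def minus_mod_eq_mult_div mod_eq_dvd_iff flip: mod_eq_dvd_iff)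

lemma finite_fundamental_cell: "finite (fundamental_cell p)"
proof (rule finite_subset[OF _ finite_l1_ball])
  show "fundamental_cell p \<subseteq> {n. l1_norm n < (\<Sum>i\<in>UNIV. int (p $ i)) + 1}"
  proof
    fix n assume "n \<in> fundamental_cell p"
    then have "0 \<le> n $ i \<and> n $ i < int (p $ i)" for i by (simp add: fundamental_cell_def)
    then have "\<bar>n $ i\<bar> \<le> int (p $ i)" for i by (simp add: less_imp_le)
    then have "l1_norm n \<le> (\<Sum>i\<in>UNIV. int (p $ i))" unfolding l1_norm_def by (intro sum_mono)
    then show "n \<in> {n. l1_norm n < (\<Sum>i\<in>UNIV. int (p $ i)) + 1}" by simp
  qed
qed

lemma min_period_le: "min_period p \<le> p $ i"
  unfolding min_period_def by (rule Min_le) auto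

lemma min_period_pos:
  assumes "\<And>i. 1 \<le> p $ i"
  shows "0 < min_period p"
  using assms unfolding min_period_def by (subst Min_gr_iff) (auto simp: Suc_le_eq)

text \<open>A nonzero displacement shorter than every period is not a period vector, so its
  endpoints have distinct representatives in the cell. In particular the set of pairs is nonempty,
  and the separation is an attained, positive, finite minimum.\<close>

lemma potential_gap:
  assumes p: "\<And>i. 1 \<le> p $ i" and V: "periodic p V" "nondegenerate p V"
    and e: "e \<noteq> 0" "l1_norm e < int (min_period p)"
  shows "0 < real_of_ereal (separation p V)" "real_of_ereal (separation p V) \<le> \<bar>V n - V (n - e)\<bar>"
proof -
  define X where "X = {(n, m). n \<in> fundamental_cell p \<and> m \<in> fundamental_cell p \<and> n \<noteq> m}"
  let ?f = "\<lambda>(n, m). ereal \<bar>V n - V m\<bar>"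
  have "finite X"
    by (rule finite_subset[of _ "fundamental_cell p \<times> fundamental_cell p"])
      (auto simp: X_def finite_fundamental_cell)
  have "cell_rep p n \<noteq> cell_rep p (n - e)"
  proof
    assume "cell_rep p n = cell_rep p (n - e)"
    then have dvd: "int (p $ i) dvd e $ i" for i by (simp add: cell_rep_eq_iff)
    have "e $ i = 0" for i
    proof (rule ccontr)
      assume "e $ i \<noteq> 0"
      then have "int (p $ i) \<le> \<bar>e $ i\<bar>" using dvd_imp_le_int[OF _ dvd[of i]] by simp
      then show False using e(2) abs_component_le_l1_norm[of e i] min_period_le[of p i] by linarith
    qed
    then show False using e(1) by (simp add: vec_eq_iff)
  qed
  then have inX: "(cell_rep p n, cell_rep p (n - e)) \<in> X"
    using cell_rep_in_cell[OF p] by (simp add: X_def)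
  have sep: "separation p V = Inf (?f ` X)" by (simp add: separation_def X_def)
  also have "\<dots> = Min (?f ` X)"
    using \<open>finite X\<close> inX by (intro Min_Inf[symmetric]) auto
  also have "\<dots> \<in> ?f ` X" using \<open>finite X\<close> inX by (intro Min_in) auto
  finally obtain a b where ab: "(a, b) \<in> X" "separation p V = ereal \<bar>V a - V b\<bar>" by auto
  then have "V a \<noteq> V b" using V(2) by (auto simp: X_def nondegenerate_def inj_on_def)
  then show "0 < real_of_ereal (separation p V)" using ab by simp
  have "separation p V \<le> ?f (cell_rep p n, cell_rep p (n - e))"
    unfolding sep by (rule INF_lower[OF inX])
  then show "real_of_ereal (separation p V) \<le> \<bar>V n - V (n - e)\<bar>"
    using ab(2) periodic_cell_rep[OF V(1)] by simp
qed

text \<open>The separation s is fixed before V, so the constants serve all potentials with that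
  separation.\<close>

proposition velocity_upper_bound:
  fixes p :: "nat ^ 'd" and \<rho>\<^sub>0 :: real
  assumes p: "\<And>i. 1 \<le> p $ i" and \<rho>: "0 < \<rho>\<^sub>0"
  shows "\<exists>C C\<^sub>1 \<mu>\<^sub>0. C > 0 \<and> C\<^sub>1 > 0 \<and> \<mu>\<^sub>0 > 0 \<and>
    (\<forall>V. periodic p V \<and> nondegenerate p V \<and> separation p V = s \<longrightarrow>
      (\<forall>n m. \<forall>\<mu> \<ge> \<mu>\<^sub>0. \<forall>t \<ge> 0.
        cmod (cinner_ell2 (delta n) (unitary_group (schroedinger_op \<mu> V) t (delta m)))
          \<le> C * exp (- \<rho>\<^sub>0 * (real_of_int (l1_norm (n - m))
                - C\<^sub>1 * \<mu> powi (- int (min_period p) + 1) * \<bar>t\<bar>))))"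
proof -
  define P where "P = min_period p"
  have P: "0 < P" unfolding P_def by (rule min_period_pos[OF p])
  \<comment> \<open>\<open>real_of_ereal\<close> sends an infinite separation to 0. The fallback
    value 1 does no harm: as soon as a displacement requires a gap, \<open>potential_gap\<close>
    makes s a positive real.\<close>
  define \<sigma> where "\<sigma> = (if 0 < real_of_ereal s then real_of_ereal s else 1)"
  have \<sigma>: "0 < \<sigma>" by (simp add: \<sigma>_def)
  \<comment> \<open>Bounds the total hopping weight for every choice of \<rho> with entries of
    modulus at most \<open>\<rho>\<^sub>0\<close>, so that nothing below depends on n and m.\<close>
  define A where "A = (\<Sum>f | l1_norm (f :: int ^ 'd) = 1. exp \<rho>\<^sub>0)"
  have A: "0 \<le> A" by (simp add: A_def)
  define N N' where "N = card {e :: int ^ 'd. l1_norm e < int P}"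
    and "N' = card {e :: int ^ 'd. l1_norm e < int (Suc P)}"
  define L where "L = 2 * (N' * (A * (4 * A / \<sigma>) ^ (P - 1)))"
  have L: "0 \<le> L" using A \<sigma> by (simp add: L_def)
  \<comment> \<open>L is the growth rate up to the power of \<mu>, and dividing by
    \<open>\<rho>\<^sub>0\<close> turns it into a velocity. The added 1 gives strict positivity from
    \<open>0 \<le> L\<close>.\<close>
  define C\<^sub>1 where "C\<^sub>1 = L / \<rho>\<^sub>0 + 1"
  define \<mu>\<^sub>0 where "\<mu>\<^sub>0 = (2 * A + 4 * A * N + 1) / \<sigma>"
  have \<mu>\<^sub>0: "0 < \<mu>\<^sub>0" using A \<sigma> by (simp add: \<mu>\<^sub>0_def add_nonneg_pos)
  show ?thesis
  proof (rule exI[of _ 3], rule exI[of _ C\<^sub>1], rule exI[of _ \<mu>\<^sub>0], intro conjI allI impI)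
    show "0 < C\<^sub>1" using L \<rho> by (simp add: C\<^sub>1_def add_nonneg_pos)
    fix V :: "int ^ 'd \<Rightarrow> real" and n m :: "int ^ 'd" and \<mu> t :: real
    assume V: "periodic p V \<and> nondegenerate p V \<and> separation p V = s" and "\<mu>\<^sub>0 \<le> \<mu>" and t: "0 \<le> t"
    have \<mu>: "0 < \<mu>" using \<mu>\<^sub>0 \<open>\<mu>\<^sub>0 \<le> \<mu>\<close> by linarith
    have "2 * A + 4 * A * N + 1 \<le> \<mu> * \<sigma>"
      using \<open>\<mu>\<^sub>0 \<le> \<mu>\<close> \<sigma> by (simp add: \<mu>\<^sub>0_def field_simps)
    moreover have "0 \<le> A * real N" using A by simp
    ultimately have \<mu>A: "2 * A \<le> \<mu> * \<sigma>" "4 * A * N \<le> \<mu> * \<sigma>" using A by linarith+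
    have bV: "bounded (range V)" using bounded_periodic[OF p] V by blast
    \<comment> \<open>The signs are chosen for the given pair n, m, so that the weight gains the
      full \<open>\<rho>\<^sub>0 * l1_norm (n - m)\<close>.\<close>
    define \<rho> where "\<rho> = (\<chi> i. \<rho>\<^sub>0 * sgn (real_of_int ((n - m) $ i)))"
    have \<rho>le: "\<bar>\<rho> $ i\<bar> \<le> \<rho>\<^sub>0" for i using \<open>0 < \<rho>\<^sub>0\<close> by (simp add: \<rho>_def abs_mult sgn_if)
    have \<rho>nm: "pairing \<rho> (n - m) = \<rho>\<^sub>0 * real_of_int (l1_norm (n - m))"
      unfolding pairing_def l1_norm_def of_int_sum sum_distrib_left
      by (rule sum.cong) (auto simp: \<rho>_def sgn_if)
    define w where "w = (\<lambda>e. exp (pairing \<rho> e))"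
    define y where "y = unitary_group (weighted_op w \<mu> V) t (delta m)"
    have "norm y \<le> 3 * exp (2 * (N' * (A * (4 * A / (\<mu> * \<sigma>)) ^ (P - 1))) * t) * norm (delta m)"
      unfolding N'_def y_def
    proof (rule eigen_row_intertwining[OF bV _ _ \<sigma> P _ \<mu> _ _ t])
      have "exp (pairing \<rho> f) \<le> exp \<rho>\<^sub>0" if "l1_norm f = 1" for f
        using abs_pairing_le[OF \<rho>le, of f] that by simp
      then show "(\<Sum>f | l1_norm f = 1. w f) \<le> A" unfolding A_def w_def by (intro sum_mono) auto
      show "\<sigma> \<le> \<bar>V n - V (n - e)\<bar>" if "e \<noteq> 0" "l1_norm e < int P" for n e
        using potential_gap(1)[OF p, where V = V and e = e] potential_gap(2)[OF p, where V = V and e = e and n = n] V that by (simp add: P_def \<sigma>_def)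
    qed (use \<mu>A in \<open>auto simp: w_def N_def\<close>)
    also have "2 * (N' * (A * (4 * A / (\<mu> * \<sigma>)) ^ (P - 1))) * t = L * (1 / \<mu> ^ (P - 1)) * t"
      by (simp add: L_def power_divide power_mult_distrib)
    also have "\<dots> \<le> \<rho>\<^sub>0 * C\<^sub>1 * (1 / \<mu> ^ (P - 1)) * t"
      using \<open>0 < \<rho>\<^sub>0\<close> \<mu> t by (intro mult_right_mono) (simp_all add: C\<^sub>1_def algebra_simps)
    finally have y: "norm y \<le> 3 * exp (\<rho>\<^sub>0 * C\<^sub>1 * (1 / \<mu> ^ (P - 1)) * t)"
      by simp
    let ?G = "ell2_apply (unitary_group (schroedinger_op \<mu> V) t (delta m)) n"
    have "exp (\<rho>\<^sub>0 * real_of_int (l1_norm (n - m))) * cmod ?G = cmod (ell2_apply y n)"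
      unfolding y_def w_def unitary_group_conjugation[OF bV] \<rho>nm by (simp add: norm_mult)
    also have "\<dots> \<le> 3 * exp (\<rho>\<^sub>0 * C\<^sub>1 * (1 / \<mu> ^ (P - 1)) * t)"
      using norm_ell2_apply_le y by (rule order_trans)
    finally have "cmod ?G \<le> 3 * (exp (\<rho>\<^sub>0 * C\<^sub>1 * (1 / \<mu> ^ (P - 1)) * t) / exp (\<rho>\<^sub>0 * real_of_int (l1_norm (n - m))))"
      by (simp add: field_simps)
    also have "\<dots> = 3 * exp (- \<rho>\<^sub>0 * (real_of_int (l1_norm (n - m)) - C\<^sub>1 * \<mu> powi (- int (min_period p) + 1) * \<bar>t\<bar>))"
      unfolding P_def[symmetric] powi_one_minus[OF P] exp_diff[symmetric]
      using t by (simp add: algebra_simps)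
    finally show "cmod (cinner_ell2 (delta n) (unitary_group (schroedinger_op \<mu> V) t (delta m)))
        \<le> 3 * exp (- \<rho>\<^sub>0 * (real_of_int (l1_norm (n - m)) - C\<^sub>1 * \<mu> powi (- int (min_period p) + 1) * \<bar>t\<bar>))"
      by (simp add: cinner_delta)
  qed (use \<mu>\<^sub>0 in auto)
qed

section \<open>Optimality\<close>

lemma sum_power_nat_abs_le:
  fixes x :: real
  assumes "0 \<le> x" "x < 1"
  shows "(\<Sum>k\<in>{- int N..int N}. x ^ nat \<bar>k\<bar>) \<le> 2 / (1 - x)"
proof -
  let ?g = "\<lambda>k :: int. x ^ nat \<bar>k\<bar>"
  let ?A = "int ` {..N}" and ?B = "(\<lambda>j. - int j) ` {..N}"
  have geo: "(\<Sum>j\<le>N. x ^ j) \<le> 1 / (1 - x)"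
    using sum_le_suminf[of "\<lambda>j. x ^ j" "{..N}"] assms by (simp add: suminf_geometric)
  have "{- int N..int N} \<subseteq> ?A \<union> ?B"
  proof
    fix k assume "k \<in> {- int N..int N}"
    then have "(k = int (nat k) \<and> nat k \<le> N) \<or> (k = - int (nat (- k)) \<and> nat (- k) \<le> N)"
      by (cases "0 \<le> k") auto
    then show "k \<in> ?A \<union> ?B" by (metis UnI1 UnI2 atMost_iff image_eqI)
  qed
  then have "sum ?g {- int N..int N} \<le> sum ?g (?A \<union> ?B)"
    using assms by (intro sum_mono2) auto
  also have "\<dots> \<le> sum ?g ?A + sum ?g ?B"
    using sum.union_inter[of ?A ?B ?g] sum_nonneg[of "?A \<inter> ?B" ?g] assms by simp
  also have "\<dots> = (\<Sum>j\<le>N. x ^ j) + (\<Sum>j\<le>N. x ^ j)"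
    by (simp add: sum.reindex inj_on_def)
  finally show ?thesis using geo by simp
qed

text \<open>The exponential factorises over coordinates, so after enlarging F to a cube the sum is a
  product of two-sided geometric sums.\<close>

lemma sum_exp_l1_norm_le:
  fixes F :: "(int ^ 'd) set"
  assumes "finite F" "0 < \<kappa>"
  shows "(\<Sum>n\<in>F. exp (- \<kappa> * real_of_int (l1_norm n))) \<le> (2 / (1 - exp (- \<kappa>))) ^ CARD('d)"
proof -
  let ?x = "exp (- \<kappa>)"
  have "\<exists>N. \<forall>n\<in>F. l1_norm n \<le> int N"
  proof (intro exI ballI)
    fix n assume "n \<in> F"
    then have "l1_norm n \<le> (\<Sum>n\<in>F. l1_norm n)" using assms by (intro member_le_sum) auto
    then show "l1_norm n \<le> int (nat (\<Sum>n\<in>F. l1_norm n))" by simp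
  qed
  then obtain N where N: "\<And>n. n \<in> F \<Longrightarrow> l1_norm n \<le> int N" by blast
  let ?P = "Pi\<^sub>E (UNIV :: 'd set) (\<lambda>_. {- int N..int N})"
  have "(\<Sum>n\<in>F. exp (- \<kappa> * real_of_int (l1_norm n))) = (\<Sum>n\<in>F. \<Prod>i\<in>UNIV. ?x ^ nat \<bar>n $ i\<bar>)"
    by (simp add: l1_norm_def sum_distrib_left exp_sum flip: exp_of_nat_mult sum_negf) (simp add: mult.commute)
  also have "\<dots> = (\<Sum>f\<in>vec_nth ` F. \<Prod>i\<in>UNIV. ?x ^ nat \<bar>f i\<bar>)"
    by (simp add: sum.reindex inj_on_def vec_nth_inject)
  also have "\<dots> \<le> (\<Sum>f\<in>?P. \<Prod>i\<in>UNIV. ?x ^ nat \<bar>f i\<bar>)"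
  proof (rule sum_mono2)
    show "finite ?P" by (intro finite_PiE) auto
    show "vec_nth ` F \<subseteq> ?P"
    proof
      fix f assume "f \<in> vec_nth ` F"
      then obtain n where n: "n \<in> F" "f = vec_nth n" by blast
      have "\<bar>n $ i\<bar> \<le> int N" for i using abs_component_le_l1_norm[of n i] N[OF n(1)] by linarith
      then show "f \<in> ?P" using n by (auto simp: abs_le_iff minus_le_iff)
    qed
  qed (auto intro: prod_nonneg)
  also have "\<dots> = (\<Prod>i\<in>(UNIV :: 'd set). \<Sum>k\<in>{- int N..int N}. ?x ^ nat \<bar>k\<bar>)"
    by (rule prod_sum_PiE[symmetric]) auto
  also have "\<dots> \<le> (2 / (1 - ?x)) ^ CARD('d)"
    using sum_power_nat_abs_le[of ?x N] assms
    by (simp add: power_mono sum_nonneg)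
  finally show ?thesis .
qed

text \<open>Half of the decay absorbs the square, by the quadratic Taylor bound at
  \<open>\<rho> / 2 * x\<close>; this is the source of the 8.\<close>

lemma square_le_exp:
  fixes x :: real
  assumes "0 < \<rho>" "0 \<le> x"
  shows "x\<^sup>2 * exp (- \<rho> * x) \<le> 8 / \<rho>\<^sup>2 * exp (- (\<rho> / 2) * x)"
proof -
  have "(\<rho> / 2 * x)\<^sup>2 / 2 \<le> exp (\<rho> / 2 * x)"
    using exp_lower_Taylor_quadratic[of "\<rho> / 2 * x"] assms
    by (smt (verit) mult_nonneg_nonneg divide_nonneg_pos)
  then have "x\<^sup>2 \<le> 8 / \<rho>\<^sup>2 * exp (\<rho> / 2 * x)"
    using assms by (simp add: power_mult_distrib field_simps)
  then have "x\<^sup>2 * exp (- \<rho> * x) \<le> 8 / \<rho>\<^sup>2 * exp (\<rho> / 2 * x) * exp (- \<rho> * x)"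
    by (intro mult_right_mono) auto
  also have "\<dots> = 8 / \<rho>\<^sup>2 * exp (- (\<rho> / 2) * x)"
    by (simp add: mult.assoc flip: exp_add)
  finally show ?thesis .
qed

lemma sum_square_exp_l1_norm_bounded:
  assumes "0 < \<rho>"
  shows "\<exists>c. \<forall>F :: (int ^ 'd) set. finite F \<longrightarrow>
    (\<Sum>n\<in>F. (real_of_int (l1_norm (n - m)))\<^sup>2 * exp (- \<rho> * real_of_int (l1_norm (n - m)))) \<le> c"
proof (intro exI allI impI)
  fix F :: "(int ^ 'd) set" assume F: "finite F"
  let ?F = "(\<lambda>n. n - m) ` F"
  have "(\<Sum>n\<in>F. (real_of_int (l1_norm (n - m)))\<^sup>2 * exp (- \<rho> * real_of_int (l1_norm (n - m))))
      \<le> (\<Sum>n\<in>F. 8 / \<rho>\<^sup>2 * exp (- (\<rho> / 2) * real_of_int (l1_norm (n - m))))"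
    by (intro sum_mono square_le_exp assms) simp
  also have "\<dots> = 8 / \<rho>\<^sup>2 * (\<Sum>n\<in>?F. exp (- (\<rho> / 2) * real_of_int (l1_norm n)))"
    by (simp add: sum_distrib_left sum.reindex inj_on_def)
  also have "\<dots> \<le> 8 / \<rho>\<^sup>2 * (2 / (1 - exp (- (\<rho> / 2)))) ^ CARD('d)"
    using F assms by (intro mult_left_mono sum_exp_l1_norm_le) auto
  finally show "(\<Sum>n\<in>F. (real_of_int (l1_norm (n - m)))\<^sup>2 * exp (- \<rho> * real_of_int (l1_norm (n - m))))
      \<le> 8 / \<rho>\<^sup>2 * (2 / (1 - exp (- (\<rho> / 2)))) ^ CARD('d)" .
qed

section \<open>Translations and sums over a cell\<close>

lemma shift_delta: "shift_ell2 e (delta m) = delta (m + e)"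
  by (rule ell2_eqI) (auto simp: shift_ell2.rep_eq delta.rep_eq)

lemma mult_op_delta:
  assumes "bounded (range V)"
  shows "mult_op V (delta m) = V m *\<^sub>R delta m"
  by (rule ell2_eqI) (simp add: mult_op_apply[OF assms] delta.rep_eq)

lemma inner_shift_left: "inner (shift_ell2 e \<psi>) \<phi> = inner \<psi> (shift_ell2 (- e) \<phi>)"
proof -
  have "bij_betw (\<lambda>n. n - e) UNIV UNIV"
    by (rule bij_betw_byWitness[of _ "\<lambda>n. n + e"]) auto
  from infsum_reindex_bij_betw[OF this, of "\<lambda>n. cnj (ell2_apply \<psi> n) * ell2_apply \<phi> (n + e)"]
  show ?thesis by (simp add: inner_ell2_Re shift_ell2.rep_eq)
qed

lemma inner_shift_shift: "inner (shift_ell2 e \<psi>) (shift_ell2 e \<phi>) = inner \<psi> \<phi>"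
proof -
  have "shift_ell2 (- e) (shift_ell2 e \<phi>) = \<phi>"
    by (rule ell2_eqI) (simp add: shift_ell2.rep_eq)
  then show ?thesis by (simp add: inner_shift_left)
qed

lemma sum_sphere_uminus: "(\<Sum>e | l1_norm e = 1. g (- e)) = (\<Sum>e | l1_norm (e :: int ^ 'd) = 1. g e)"
  by (rule sum.reindex_bij_witness[of _ uminus uminus]) auto

text \<open>Translation followed by reduction into the cell permutes the cell, and g does not notice
  the reduction.\<close>

lemma sum_cell_shift:
  fixes g :: "int ^ 'd \<Rightarrow> 'b::comm_monoid_add"
  assumes p: "\<And>i. 1 \<le> p $ i" and g: "\<And>n m. (\<And>i. int (p $ i) dvd n $ i - m $ i) \<Longrightarrow> g n = g m"
  shows "(\<Sum>m\<in>fundamental_cell p. g (m + a)) = (\<Sum>m\<in>fundamental_cell p. g m)"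
proof (rule sum.reindex_bij_witness[of _ "\<lambda>m. cell_rep p (m - a)" "\<lambda>m. cell_rep p (m + a)"])
  have fix_cell: "cell_rep p m = m" if "m \<in> fundamental_cell p" for m
    using that by (simp add: cell_rep_def fundamental_cell_def vec_eq_iff)
  have rep: "int (p $ i) dvd cell_rep p n $ i - n $ i" for n i
    by (simp add: cell_rep_def flip: mod_eq_dvd_iff)
  have add: "cell_rep p (cell_rep p n + b) = cell_rep p (n + b)" for n b
    unfolding cell_rep_eq_iff using rep[of _ n] by simp
  fix m assume m: "m \<in> fundamental_cell p"
  show "cell_rep p (cell_rep p (m + a) - a) = m" "cell_rep p (cell_rep p (m - a) + a) = m"
    using add[of "m + a" "- a"] add[of "m - a" a] fix_cell[OF m] by simp_all
  show "cell_rep p (m + a) \<in> fundamental_cell p" "cell_rep p (m - a) \<in> fundamental_cell p"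
    by (rule cell_rep_in_cell[OF p])+
  show "g (cell_rep p (m + a)) = g (m + a)" by (rule g[OF rep])
qed

section \<open>Powers and evolution of the Schroedinger operator\<close>

context
  fixes V :: "int ^ 'd \<Rightarrow> real" and \<mu> :: real
  assumes V: "bounded (range V)"
begin

private abbreviation (input) "H \<equiv> schroedinger_op \<mu> V"
private abbreviation (input) "G t m \<equiv> unitary_group H t (delta m)"

lemma complex_bounded_linear_schroedinger: "complex_bounded_linear H"
  unfolding schroedinger_op_eq_weighted_op by (rule complex_bounded_linear_weighted_op[OF V])

lemma schroedinger_apply:
  "ell2_apply (H \<psi>) n = (\<Sum>e | l1_norm e = 1. ell2_apply \<psi> (n - e)) + of_real (\<mu> * V n) * ell2_apply \<psi> n"
  by (simp add: schroedinger_op_eq_weighted_op weighted_op_apply[OF V])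

lemma schroedinger_symmetric: "inner (H \<psi>) \<phi> = inner \<psi> (H \<phi>)"
proof -
  have "(\<Sum>e | l1_norm e = 1. inner (shift_ell2 e \<psi>) \<phi>) = (\<Sum>e | l1_norm (e :: int ^ 'd) = 1. inner \<psi> (shift_ell2 e \<phi>))"
    unfolding inner_shift_left using sum_sphere_uminus[of "\<lambda>e. inner \<psi> (shift_ell2 e \<phi>)"] .
  then show ?thesis
    by (simp add: schroedinger_op_def lattice_laplacian_eq_shifts inner_add_left inner_add_right
        inner_sum_left inner_sum_right inner_mult_op[OF V])
qed

lemma complex_bounded_linear_funpow: "complex_bounded_linear (H ^^ k)"
proof (induction k)
  case 0
  then show ?case by (simp add: complex_bounded_linear_def id_def bounded_linear_ident)
next
  case (Suc k)
  then show ?case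
    using complex_bounded_linear_compose[OF complex_bounded_linear_schroedinger] by (simp add: o_def)
qed

lemma schroedinger_delta:
  "H (delta m) = (\<Sum>e | l1_norm e = 1. delta (m + e)) + (\<mu> * V m) *\<^sub>R delta m"
  by (simp add: schroedinger_op_def lattice_laplacian_eq_shifts shift_delta mult_op_delta[OF V])

text \<open>Peeling off the innermost factor lets H act from the right, expressing the column at m
  through the columns at neighbouring sites.\<close>

lemma schroedinger_funpow_Suc_delta:
  "(H ^^ Suc k) (delta m) = (\<Sum>e | l1_norm e = 1. (H ^^ k) (delta (m + e))) + (\<mu> * V m) *\<^sub>R (H ^^ k) (delta m)"
proof -
  have lin: "linear (H ^^ k)"
    by (rule bounded_linear.linear[OF complex_bounded_linearD(1)[OF complex_bounded_linear_funpow]])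
  have "(H ^^ Suc k) (delta m) = (H ^^ k) (H (delta m))" by (simp add: funpow_swap1)
  then show ?thesis by (simp add: schroedinger_delta linear_add[OF lin] linear_sum[OF lin] linear_scale[OF lin])
qed

lemma schroedinger_funpow_support:
  assumes "int k < l1_norm (n - m)"
  shows "ell2_apply ((H ^^ k) (delta m)) n = 0"
  using assms
proof (induction k arbitrary: n)
  case 0
  then have "n \<noteq> m" by auto
  then show ?case by (simp add: delta.rep_eq)
next
  case (Suc k)
  have "ell2_apply ((H ^^ k) (delta m)) (n - e) = 0" if "l1_norm e = 1" for e
    using Suc.prems that l1_norm_triangle_diff[of "n - m" e] by (intro Suc.IH) (simp add: algebra_simps)
  then show ?case using Suc by (simp add: schroedinger_apply)
qed

text \<open>The time derivative vanishes because H is symmetric and multiplication by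
  \<open>\<i>\<close> is skew.\<close>

lemma unitary_group_isometry: "inner (unitary_group H t \<psi>) (unitary_group H t \<phi>) = inner \<psi> \<phi>"
proof -
  let ?f = "\<lambda>t. inner (unitary_group H t \<psi>) (unitary_group H t \<phi>)"
  note d = unitary_group_has_vector_derivative[OF complex_bounded_linear_schroedinger]
  have "(?f has_real_derivative 0) (at t)" for t
  proof -
    let ?a = "unitary_group H t \<psi>" and ?b = "unitary_group H t \<phi>"
    have "inner ?a (- (\<i> *\<^sub>C H ?b)) + inner (- (\<i> *\<^sub>C H ?a)) ?b = 0"
      using schroedinger_symmetric[of ?a "\<i> *\<^sub>C ?b"]
      by (simp add: inner_scaleC_ii_left complex_bounded_linearD(2)[OF complex_bounded_linear_schroedinger])
    then show ?thesis using has_real_derivative_inner[OF d[of \<psi> t] d[of \<phi> t]] by simp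
  qed
  then have "?f t = ?f 0" by (intro DERIV_isconst_all) blast
  then show ?thesis by (simp add: unitary_group_eq exp_series_0)
qed

lemma norm_unitary_group: "norm (unitary_group H t \<psi>) = norm \<psi>"
  by (simp add: norm_eq_sqrt_inner unitary_group_isometry)

lemma unitary_group_funpow: "unitary_group H t ((H ^^ k) \<psi>) = (H ^^ k) (unitary_group H t \<psi>)"
proof -
  have "(H ^^ j) ((H ^^ k) \<psi>) = (H ^^ k) ((H ^^ j) \<psi>)" for j
    by (metis add.commute comp_apply funpow_add)
  then show ?thesis
    unfolding unitary_group_eq
    by (simp add: exp_series_bounded_linear[OF geometric_growth_funpow[OF
          complex_bounded_linearD(1)[OF complex_bounded_linear_schroedinger]] complex_bounded_linear_funpow])
qed

lemma geometric_growth_G: "geometric_growth (\<lambda>k. (H ^^ k) \<psi>)"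
  by (rule geometric_growth_funpow[OF complex_bounded_linearD(1)[OF complex_bounded_linear_schroedinger]])

lemma G_has_vector_derivative:
  "((\<lambda>t. G t m) has_vector_derivative
    - (\<i> *\<^sub>C ((\<Sum>e | l1_norm e = 1. G t (m + e)) + (\<mu> * V m) *\<^sub>R G t m))) (at t)"
proof -
  have "exp_series (\<lambda>k. (H ^^ Suc k) (delta m)) t = (\<Sum>e | l1_norm e = 1. G t (m + e)) + (\<mu> * V m) *\<^sub>R G t m"
    unfolding schroedinger_funpow_Suc_delta unitary_group_eq
    by (simp add: exp_series_add exp_series_sum exp_series_scaleR geometric_growth_G
        geometric_growth_sum geometric_growth_scaleR)
  then show ?thesis
    using exp_series_has_vector_derivative[OF geometric_growth_G, of "delta m" t]
    by (simp add: unitary_group_eq[abs_def])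
qed

text \<open>The cut-off keeps the multiplier bounded. It does not change the product, because the \<open>k\<close>-th
  power of \<open>H\<close> moves \<open>delta m\<close> by at most \<open>k\<close> sites (\<open>moment_apply\<close>).\<close>

definition moment :: "'d \<Rightarrow> int ^ 'd \<Rightarrow> nat \<Rightarrow> (int ^ 'd) ell2" where
  "moment i m k = mult_op (\<lambda>n. if l1_norm (n - m) \<le> int k then of_int ((n - m) $ i) else 0) ((H ^^ k) (delta m))"

lemma moment_coefficient_le:
  "\<bar>if l1_norm (n - m) \<le> int k then real_of_int ((n - m) $ i) else 0\<bar> \<le> real k"
proof -
  have "\<bar>real_of_int ((n - m) $ i)\<bar> \<le> real k" if "l1_norm (n - m) \<le> int k"
    using abs_component_le_l1_norm[of "n - m" i] that by linarith
  then show ?thesis by auto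
qed

lemma moment_apply:
  "ell2_apply (moment i m k) n = of_int ((n - m) $ i) * ell2_apply ((H ^^ k) (delta m)) n"
  unfolding moment_def mult_op_apply[OF bounded_rangeI_abs[OF moment_coefficient_le]]
  using schroedinger_funpow_support[of k n m] by simp

text \<open>The position factor is at most k, and k \<le> 2^k is absorbed by doubling the
  ratio.\<close>

lemma geometric_growth_moment: "geometric_growth (moment i m)"
proof -
  obtain M B where MB: "\<And>k. norm ((H ^^ k) (delta m)) \<le> M * B ^ k" "0 \<le> M" "0 \<le> B"
    using geometric_growthE[OF geometric_growth_G] by metis
  have "norm (moment i m k) \<le> M * (2 * B) ^ k" for k
  proof -
    have "norm (moment i m k) \<le> real k * norm ((H ^^ k) (delta m))"
      unfolding moment_def by (rule norm_mult_op_le[OF moment_coefficient_le])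
    also have "\<dots> \<le> 2 ^ k * (M * B ^ k)"
      using MB of_nat_less_two_power[of k, where 'a = real] by (intro mult_mono) auto
    finally show ?thesis by (simp add: power_mult_distrib mult_ac)
  qed
  then show ?thesis unfolding geometric_growth_def by blast
qed

lemma moment_0: "moment i m 0 = 0"
  by (rule ell2_eqI) (simp add: moment_apply delta.rep_eq zero_ell2.rep_eq)

text \<open>Writing n - m as (n - (m + e)) + e splits the position weight into that of the
  neighbouring column and an extra hop. The extra term is the current [X, H].\<close>

lemma moment_Suc:
  "moment i m (Suc k) = (\<Sum>e | l1_norm e = 1. moment i (m + e) k + of_int (e $ i) *\<^sub>R (H ^^ k) (delta (m + e)))
    + (\<mu> * V m) *\<^sub>R moment i m k"
proof (rule ell2_eqI)
  fix n
  let ?a = "\<lambda>m. ell2_apply ((H ^^ k) (delta m)) n"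
  have "ell2_apply (moment i m (Suc k)) n
      = (\<Sum>e | l1_norm e = 1. of_int ((n - m) $ i) * ?a (m + e)) + of_int ((n - m) $ i) * (of_real (\<mu> * V m) * ?a m)"
    unfolding moment_apply schroedinger_funpow_Suc_delta
    by (simp add: plus_ell2.rep_eq ell2_apply_sum distrib_left sum_distrib_left)
  also have "\<dots> = ell2_apply ((\<Sum>e | l1_norm e = 1. moment i (m + e) k + of_int (e $ i) *\<^sub>R (H ^^ k) (delta (m + e)))
    + (\<mu> * V m) *\<^sub>R moment i m k) n"
    by (simp add: plus_ell2.rep_eq ell2_apply_sum moment_apply algebra_simps)
  finally show "ell2_apply (moment i m (Suc k)) n = ell2_apply ((\<Sum>e | l1_norm e = 1. moment i (m + e) k
    + of_int (e $ i) *\<^sub>R (H ^^ k) (delta (m + e))) + (\<mu> * V m) *\<^sub>R moment i m k) n" .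
qed

text \<open>Column m of the commutator [X, exp(-itH)] for the i-th position X. Since X is unbounded,
  the column is defined by a series and identified entrywise in
  \<open>displacement_apply\<close>.\<close>

definition displacement :: "'d \<Rightarrow> real \<Rightarrow> int ^ 'd \<Rightarrow> (int ^ 'd) ell2" where
  "displacement i t m = exp_series (moment i m) t"

lemma displacement_apply:
  "ell2_apply (displacement i t m) n = of_int ((n - m) $ i) * ell2_apply (G t m) n"
proof -
  have s: "summable (\<lambda>k. (- \<i> * complex_of_real t) ^ k / fact k * ell2_apply ((H ^^ k) (delta m)) n)"
    using bounded_linear.summable[OF bounded_linear_ell2_apply exp_series_summable[OF geometric_growth_G]]
    by (simp add: scaleC_ell2.rep_eq)
  show ?thesis
    unfolding displacement_def unitary_group_eq ell2_apply_exp_series[OF geometric_growth_moment]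
      ell2_apply_exp_series[OF geometric_growth_G] moment_apply
    using suminf_mult[OF s, of "of_int ((n - m) $ i)"] by (simp add: mult_ac)
qed

lemma displacement_has_vector_derivative:
  "((\<lambda>t. displacement i t m) has_vector_derivative
    - (\<i> *\<^sub>C ((\<Sum>e | l1_norm e = 1. displacement i t (m + e) + of_int (e $ i) *\<^sub>R G t (m + e))
      + (\<mu> * V m) *\<^sub>R displacement i t m))) (at t)"
proof -
  have "exp_series (\<lambda>k. moment i m (Suc k)) t =
      (\<Sum>e | l1_norm e = 1. displacement i t (m + e) + of_int (e $ i) *\<^sub>R G t (m + e)) + (\<mu> * V m) *\<^sub>R displacement i t m"
    unfolding moment_Suc unitary_group_eq displacement_def
    by (simp add: exp_series_add exp_series_sum exp_series_scaleR geometric_growth_G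
        geometric_growth_sum geometric_growth_add geometric_growth_scaleR geometric_growth_moment)
  then show ?thesis
    using exp_series_has_vector_derivative[OF geometric_growth_moment, of i m t]
    by (simp add: displacement_def[abs_def])
qed

lemma schroedinger_shift:
  assumes "periodic p V" "\<And>i. int (p $ i) dvd a $ i"
  shows "H (shift_ell2 a \<psi>) = shift_ell2 a (H \<psi>)"
proof (rule ell2_eqI)
  fix n
  have "V n = V (n - a)" using assms by (intro periodic_eqI[OF assms(1)]) simp
  then show "ell2_apply (H (shift_ell2 a \<psi>)) n = ell2_apply (shift_ell2 a (H \<psi>)) n"
    by (simp add: schroedinger_apply shift_ell2.rep_eq algebra_simps)
qed

context
  fixes p :: "nat ^ 'd" and a :: "int ^ 'd"
  assumes p: "periodic p V" and a: "\<And>i. int (p $ i) dvd a $ i"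
begin

lemma funpow_delta_shift: "(H ^^ k) (delta (m + a)) = shift_ell2 a ((H ^^ k) (delta m))"
  by (induction k) (simp_all add: shift_delta schroedinger_shift[OF p a])

lemma G_shift: "G t (m + a) = shift_ell2 a (G t m)"
  unfolding unitary_group_eq funpow_delta_shift
  by (rule exp_series_bounded_linear[OF geometric_growth_G complex_bounded_linear_shift, symmetric])

lemma displacement_shift: "displacement i t (m + a) = shift_ell2 a (displacement i t m)"
  by (rule ell2_eqI)
    (simp only: displacement_apply G_shift shift_ell2.rep_eq, simp add: algebra_simps)

lemma funpow_G_shift: "(H ^^ k) (G t (m + a)) = shift_ell2 a ((H ^^ k) (G t m))"
  unfolding G_shift by (induction k) (simp_all add: schroedinger_shift[OF p a])

end

section \<open>Straight paths and the current\<close>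

text \<open>Only the straight path covers k sites along one axis in k steps, and each hop has weight
  1.\<close>

lemma funpow_delta_straight: "ell2_apply ((H ^^ k) (delta m)) (m - axis i (int k)) = 1"
proof (induction k)
  case 0
  have "axis i (0::int) = (0 :: int ^ 'd)" by (simp add: axis_def vec_eq_iff)
  then show ?case by (simp add: delta.rep_eq)
next
  case (Suc k)
  let ?x = "m - axis i (int (Suc k))"
  \<comment> \<open>The target is k + 1 sites away, so the potential term of the last step
    contributes nothing.\<close>
  have z: "ell2_apply ((H ^^ k) (delta m)) ?x = 0"
    by (intro schroedinger_funpow_support) simp
  have u: "l1_norm (- axis i 1 :: int ^ 'd) = 1" by simp
  have "ell2_apply ((H ^^ k) (delta m)) (?x - e) = 0" if e: "l1_norm e = 1" "e \<noteq> - axis i 1" for e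
  proof (rule schroedinger_funpow_support)
    have "e $ i \<noteq> -1"
    proof
      assume "e $ i = -1"
      then have "e = - axis i 1" using unit_vector_eq_axis[OF e(1), of i] by (simp add: axis_def vec_eq_iff)
      then show False using e(2) by simp
    qed
    then have "0 \<le> e $ i" using abs_component_le_l1_norm[of e i] e(1) by linarith
    moreover have "\<bar>(?x - e - m) $ i\<bar> \<le> l1_norm (?x - e - m)" by (rule abs_component_le_l1_norm)
    moreover have "(?x - e - m) $ i = - int (Suc k) - e $ i" by (simp add: axis_def)
    ultimately show "int k < l1_norm (?x - e - m)" by linarith
  qed
  then have "(\<Sum>e | l1_norm e = 1. ell2_apply ((H ^^ k) (delta m)) (?x - e))
      = (\<Sum>e\<in>{- axis i 1}. ell2_apply ((H ^^ k) (delta m)) (?x - e))"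
    using u by (intro sum.mono_neutral_right finite_l1_sphere) auto
  also have "\<dots> = ell2_apply ((H ^^ k) (delta m)) (?x - (- axis i 1))" by simp
  also have "?x - (- axis i 1) = m - axis i (int k)" by (simp add: axis_def vec_eq_iff)
  also have "ell2_apply ((H ^^ k) (delta m)) (m - axis i (int k)) = 1" by (rule Suc.IH)
  finally show ?case using z by (simp add: schroedinger_apply)
qed

text \<open>From P sites away, P - 1 steps reach a neighbour m + e only by the straight path with e
  = \<open>axis i 1\<close>, among those with nonzero i-th component. Sideways hops carry weight 0,
  and backward ones are out of reach.\<close>

lemma hopping_current:
  assumes "0 < P"
  shows "(\<Sum>e | l1_norm e = 1. real_of_int (e $ i) *
    inner ((H ^^ (P - 1)) (delta (m + axis i (int P)))) (delta (m + e))) = 1"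
proof -
  let ?f = "\<lambda>e. inner ((H ^^ (P - 1)) (delta (m + axis i (int P)))) (delta (m + e))"
  have u: "l1_norm (axis i 1 :: int ^ 'd) = 1" by simp
  have "real_of_int (e $ i) * ?f e = 0" if e: "l1_norm e = 1" "e \<noteq> axis i 1" for e
  proof -
    have "e $ i \<noteq> 1" using e unit_vector_eq_axis[OF e(1), of i] by auto
    then consider "e $ i = 0" | "e $ i \<le> -1"
      using abs_component_le_l1_norm[of e i] e(1) by linarith
    then show ?thesis
    proof cases
      case 2
      have "\<bar>(m + e - (m + axis i (int P))) $ i\<bar> \<le> l1_norm (m + e - (m + axis i (int P)))"
        by (rule abs_component_le_l1_norm)
      moreover have "(m + e - (m + axis i (int P))) $ i = e $ i - int P" by (simp add: axis_def)
      ultimately have "int (P - 1) < l1_norm (m + e - (m + axis i (int P)))" using 2 by linarith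
      then show ?thesis by (simp add: inner_delta_right schroedinger_funpow_support)
    qed simp
  qed
  then have "(\<Sum>e | l1_norm e = 1. real_of_int (e $ i) * ?f e) = (\<Sum>e\<in>{axis i 1}. real_of_int (e $ i) * ?f e)"
    using u by (intro sum.mono_neutral_right finite_l1_sphere) auto
  also have "\<dots> = Re (ell2_apply ((H ^^ (P - 1)) (delta (m + axis i (int P)))) (m + axis i 1))"
    by (simp add: inner_delta_right axis_def)
  also have "m + axis i 1 = m + axis i (int P) - axis i (int (P - 1))"
    using assms by (simp add: axis_def vec_eq_iff of_nat_diff)
  also have "Re (ell2_apply ((H ^^ (P - 1)) (delta (m + axis i (int P)))) \<dots>) = 1"
    by (simp only: funpow_delta_straight one_complex.sel)
  finally show ?thesis .
qed

text \<open>Per unit cell, this is the trace of \<open>U\<^sup>* H\<^sup>P\<^sup>-\<^sup>1 e\<^sup>i\<^sup>t\<^sup>H [X, e\<^sup>-\<^sup>i\<^sup>t\<^sup>H]\<close>, where \<open>U\<close> is the translation by one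
  period in direction \<open>i\<close>. Letting \<open>H\<close> act from the right on the columns \<open>G t m\<close>, the terms of the
  derivative not involving the current cancel by periodicity.\<close>

lemma accumulated_current:
  fixes p :: "nat ^ 'd" and t :: real
  assumes p: "\<And>i. 1 \<le> p $ i" "periodic p V"
  shows "(\<Sum>m\<in>fundamental_cell p.
      inner ((H ^^ (p $ i - 1)) (G t (m + axis i (int (p $ i))))) (\<i> *\<^sub>C displacement i t m))
    = card (fundamental_cell p) * t"
proof -
  define P where "P = p $ i"
  define q where "q = (axis i (int P) :: int ^ 'd)"
  define \<eta> where "\<eta> = (\<lambda>t m. (H ^^ (P - 1)) (G t (m + q)))"
  define W where "W = fundamental_cell p"
  have P: "0 < P" using p(1)[of i] by (simp add: P_def)
  have q: "int (p $ j) dvd q $ j" for j by (simp add: q_def axis_def P_def)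
  let ?K = "displacement i"
  let ?f = "\<lambda>t. \<Sum>m\<in>W. inner (\<eta> t m) (\<i> *\<^sub>C ?K t m)"
  \<comment> \<open>Translation by the period q does not change the potential, so these columns obey
    the same equation as those at m.\<close>
  have \<eta>': "((\<lambda>t. \<eta> t m) has_vector_derivative
      - (\<i> *\<^sub>C ((\<Sum>e | l1_norm e = 1. \<eta> t (m + e)) + (\<mu> * V m) *\<^sub>R \<eta> t m))) (at t)" for m t
  proof -
    note cbl = complex_bounded_linear_funpow[of "P - 1"]
    note lin = bounded_linear.linear[OF complex_bounded_linearD(1)[OF cbl]]
    have "V (m + q) = V m" by (rule periodic_eqI[OF p(2)]) (simp add: q)
    then show ?thesis
      using bounded_linear.has_vector_derivative[OF complex_bounded_linearD(1)[OF cbl] G_has_vector_derivative[of "m + q" t]]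
      by (simp add: \<eta>_def complex_bounded_linearD(2)[OF cbl] linear_neg[OF lin] linear_add[OF lin]
          linear_sum[OF lin] linear_scale[OF lin] ac_simps del: One_nat_def)
  qed
  \<comment> \<open>Powers of H commute with the isometric evolution, which makes the current
    constant in time.\<close>
  have iso: "inner (\<eta> t m) (G t (m + e)) = inner ((H ^^ (P - 1)) (delta (m + q))) (delta (m + e))" for t m e
    unfolding \<eta>_def unitary_group_funpow[symmetric] by (rule unitary_group_isometry)
  have f': "(?f has_real_derivative card W) (at t)" for t
  proof -
    have "((\<lambda>t. inner (\<eta> t m) (\<i> *\<^sub>C ?K t m)) has_real_derivative
        (\<Sum>e | l1_norm e = 1. inner (\<eta> t m) (?K t (m + e))) - (\<Sum>e | l1_norm e = 1. inner (\<eta> t (m + e)) (?K t m)) + 1) (at t)" for m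
    proof -
      define Y where "Y = (\<Sum>e | l1_norm e = 1. \<eta> t (m + e)) + (\<mu> * V m) *\<^sub>R \<eta> t m"
      define Z where "Z = (\<Sum>e | l1_norm e = 1. ?K t (m + e) + of_int (e $ i) *\<^sub>R G t (m + e)) + (\<mu> * V m) *\<^sub>R ?K t m"
      have "((\<lambda>t. \<i> *\<^sub>C ?K t m) has_vector_derivative Z) (at t)"
        using bounded_linear.has_vector_derivative[OF bounded_linear_scaleC[of \<i>] displacement_has_vector_derivative[of i m t, folded Z_def]]
        by (simp add: scaleC_minus)
      from has_real_derivative_inner[OF \<eta>'[of m t] this]
      have d: "((\<lambda>t. inner (\<eta> t m) (\<i> *\<^sub>C ?K t m)) has_real_derivative
          inner (\<eta> t m) Z - inner Y (?K t m)) (at t)"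
        by (simp add: Y_def[symmetric] inner_scaleC_ii)
      have "(\<Sum>e | l1_norm e = 1. real_of_int (e $ i) * inner (\<eta> t m) (G t (m + e))) = 1"
        unfolding iso q_def by (rule hopping_current[OF P])
      then have "inner (\<eta> t m) Z - inner Y (?K t m) = (\<Sum>e | l1_norm e = 1. inner (\<eta> t m) (?K t (m + e)))
          - (\<Sum>e | l1_norm e = 1. inner (\<eta> t (m + e)) (?K t m)) + 1"
        by (simp add: Y_def Z_def inner_add_left inner_add_right inner_sum_left inner_sum_right sum.distrib)
      then show ?thesis using d by simp
    qed
    then have "(?f has_real_derivative (\<Sum>m\<in>W. (\<Sum>e | l1_norm e = 1. inner (\<eta> t m) (?K t (m + e)))
        - (\<Sum>e | l1_norm e = 1. inner (\<eta> t (m + e)) (?K t m)) + 1)) (at t)"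
      by (intro DERIV_sum)
    \<comment> \<open>Cyclicity of the trace per cell: translating by -e moves the hop to the other
      factor, and the sphere of hops is symmetric under negation.\<close>
    moreover have "(\<Sum>m\<in>W. \<Sum>e | l1_norm e = 1. inner (\<eta> t m) (?K t (m + e)))
        = (\<Sum>m\<in>W. \<Sum>e | l1_norm e = 1. inner (\<eta> t (m + e)) (?K t m))"
    proof -
      have "(\<Sum>m\<in>W. inner (\<eta> t m) (?K t (m + e))) = (\<Sum>m\<in>W. inner (\<eta> t (m - e)) (?K t m))" for e
      proof -
        have periodic: "inner (\<eta> t (n - e)) (?K t n) = inner (\<eta> t (m - e)) (?K t m)"
          if "\<And>j. int (p $ j) dvd n $ j - m $ j" for n m
        proof -
          have dvd: "int (p $ j) dvd (n - m) $ j" for j using that by simp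
          have "\<eta> t (n - e) = shift_ell2 (n - m) (\<eta> t (m - e))"
            using funpow_G_shift[OF p(2) dvd, of "P - 1" t "m - e + q"] by (simp add: \<eta>_def algebra_simps)
          moreover have "?K t n = shift_ell2 (n - m) (?K t m)"
            using displacement_shift[OF p(2) dvd, of i t m] by simp
          ultimately show ?thesis by (simp add: inner_shift_shift)
        qed
        have "(\<Sum>m\<in>W. inner (\<eta> t (m + e - e)) (?K t (m + e))) = (\<Sum>m\<in>W. inner (\<eta> t (m - e)) (?K t m))"
          unfolding W_def
          by (rule sum_cell_shift[of p "\<lambda>n. inner (\<eta> t (n - e)) (?K t n)"], rule p(1), rule periodic)
        then show ?thesis by simp
      qed
      then have "(\<Sum>e | l1_norm e = 1. \<Sum>m\<in>W. inner (\<eta> t m) (?K t (m + e)))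
          = (\<Sum>e | l1_norm e = 1. \<Sum>m\<in>W. inner (\<eta> t (m + (- e))) (?K t m))" by simp
      also have "\<dots> = (\<Sum>e | l1_norm e = 1. \<Sum>m\<in>W. inner (\<eta> t (m + e)) (?K t m))"
        by (rule sum_sphere_uminus[of "\<lambda>e. \<Sum>m\<in>W. inner (\<eta> t (m + e)) (?K t m)"])
      finally show ?thesis by (simp only: sum.swap[of _ _ W])
    qed
    ultimately show ?thesis by (simp add: sum.distrib sum_subtractf)
  qed
  have "((\<lambda>t. ?f t - card W * t) has_real_derivative 0) (at t)" for t
    by (rule derivative_eq_intros f' refl | simp)+
  then have "?f t - card W * t = ?f 0 - real (card W) * 0"
    using DERIV_isconst_all[of "\<lambda>t. ?f t - card W * t" t 0] by blast
  moreover have "?f 0 = 0" by (simp add: displacement_def exp_series_0 moment_0)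
  ultimately show ?thesis by (simp add: W_def \<eta>_def q_def P_def)
qed

lemma norm_schroedinger_le:
  assumes "\<And>n. \<bar>V n\<bar> \<le> B" "0 \<le> \<mu>"
  shows "norm (H \<psi>) \<le> (real (card {e :: int ^ 'd. l1_norm e = 1}) + \<mu> * B) * norm \<psi>"
proof -
  have "norm (H \<psi>) \<le> (\<Sum>e | l1_norm (e :: int ^ 'd) = 1. norm (shift_ell2 e \<psi>)) + norm (\<mu> *\<^sub>R mult_op V \<psi>)"
    unfolding schroedinger_op_def lattice_laplacian_eq_shifts
    by (intro norm_triangle_le add_right_mono norm_sum)
  also have "\<dots> \<le> (\<Sum>e | l1_norm (e :: int ^ 'd) = 1. norm \<psi>) + \<mu> * (B * norm \<psi>)"
    using norm_mult_op_le[OF assms(1), where \<psi> = \<psi>] assms(2) by (simp add: norm_shift_ell2 mult_left_mono)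
  finally show ?thesis by (simp add: algebra_simps)
qed

text \<open>The region outside twice the light cone contributes a bounded amount, since there
  \<open>r - v * t \<ge> r / 2\<close>.\<close>

lemma norm_displacement_le:
  assumes LR: "\<And>n t. 0 \<le> t \<Longrightarrow>
      cmod (ell2_apply (G t m) n) \<le> K * exp (- \<rho> * (real_of_int (l1_norm (n - m)) - v * t))"
    and pos: "0 < K" "0 < \<rho>" "0 < v"
  shows "\<exists>c\<ge>0. \<forall>t\<ge>0. norm (displacement i t m) \<le> 2 * v * t + c"
proof -
  obtain c where c: "\<And>F. finite F \<Longrightarrow>
      (\<Sum>n\<in>F. (real_of_int (l1_norm (n - m)))\<^sup>2 * exp (- \<rho> * real_of_int (l1_norm (n - m)))) \<le> c"
    using sum_square_exp_l1_norm_bounded[OF pos(2), of m] by blast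
  have c0: "0 \<le> c" using c[of "{}"] by simp
  have "norm (displacement i t m) \<le> 2 * v * t + K * sqrt c" if t: "0 \<le> t" for t
  proof (rule norm_ell2_leI)
    show "0 \<le> 2 * v * t + K * sqrt c" using pos t c0 by simp
    fix F :: "(int ^ 'd) set" assume F: "finite F"
    let ?r = "\<lambda>n. real_of_int (l1_norm (n - m))" and ?g = "\<lambda>n. cmod (ell2_apply (G t m) n)"
    have "(\<Sum>n\<in>F. (cmod (ell2_apply (displacement i t m) n))\<^sup>2)
        \<le> (\<Sum>n\<in>F. (2 * v * t)\<^sup>2 * (?g n)\<^sup>2 + K\<^sup>2 * ((?r n)\<^sup>2 * exp (- \<rho> * ?r n)))"
    proof (rule sum_mono)
      fix n
      have "\<bar>real_of_int ((n - m) $ i)\<bar> \<le> ?r n"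
        using abs_component_le_l1_norm[of "n - m" i] by linarith
      then have "cmod (ell2_apply (displacement i t m) n) \<le> ?r n * ?g n"
        unfolding displacement_apply norm_mult norm_of_int by (intro mult_right_mono) simp_all
      from power_mono[OF this, of 2]
      have "(cmod (ell2_apply (displacement i t m) n))\<^sup>2 \<le> (?r n)\<^sup>2 * (?g n)\<^sup>2"
        by (simp add: power_mult_distrib)
      also have "\<dots> \<le> (2 * v * t)\<^sup>2 * (?g n)\<^sup>2 + K\<^sup>2 * ((?r n)\<^sup>2 * exp (- \<rho> * ?r n))"
      proof (cases "?r n \<le> 2 * v * t")
        case True
        then have "(?r n)\<^sup>2 * (?g n)\<^sup>2 \<le> (2 * v * t)\<^sup>2 * (?g n)\<^sup>2"
          by (intro mult_right_mono power_mono) auto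
        then show ?thesis by (simp add: add_increasing2)
      next
        case False
        have "?g n \<le> K * exp (- \<rho> * (?r n - v * t))" by (rule LR[OF t])
        also have "\<dots> \<le> K * exp (- \<rho> * ?r n / 2)"
          using False pos by (simp add: field_simps)
        finally have "(?g n)\<^sup>2 \<le> (K * exp (- \<rho> * ?r n / 2))\<^sup>2" by (intro power_mono) auto
        also have "\<dots> = K\<^sup>2 * exp (- \<rho> * ?r n)"
          using exp_double[of "- \<rho> * ?r n / 2"] by (simp add: power_mult_distrib)
        finally have "(?r n)\<^sup>2 * (?g n)\<^sup>2 \<le> (?r n)\<^sup>2 * (K\<^sup>2 * exp (- \<rho> * ?r n))"
          by (intro mult_left_mono) auto
        then show ?thesis by (simp add: mult_ac add_increasing)
      qed
      finally show "(cmod (ell2_apply (displacement i t m) n))\<^sup>2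
        \<le> (2 * v * t)\<^sup>2 * (?g n)\<^sup>2 + K\<^sup>2 * ((?r n)\<^sup>2 * exp (- \<rho> * ?r n))" .
    qed
    also have "\<dots> = (2 * v * t)\<^sup>2 * (\<Sum>n\<in>F. (?g n)\<^sup>2) + K\<^sup>2 * (\<Sum>n\<in>F. (?r n)\<^sup>2 * exp (- \<rho> * ?r n))"
      by (simp add: sum.distrib sum_distrib_left)
    \<comment> \<open>Near the cone, the full mass of the column is used: it has norm 1 by
      unitarity.\<close>
    also have "\<dots> \<le> (2 * v * t)\<^sup>2 * 1 + K\<^sup>2 * c"
      using finite_sum_le_norm_ell2[OF F, of "G t m"] c[OF F]
      by (intro add_mono mult_left_mono) (simp_all add: norm_unitary_group)
    also have "\<dots> \<le> (2 * v * t + K * sqrt c)\<^sup>2"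
      using c0 pos t by (simp add: power2_sum power_mult_distrib)
    finally show "(\<Sum>n\<in>F. (cmod (ell2_apply (displacement i t m) n))\<^sup>2) \<le> (2 * v * t + K * sqrt c)\<^sup>2" .
  qed
  moreover have "0 \<le> K * sqrt c" using pos c0 by simp
  ultimately show ?thesis by blast
qed

text \<open>Cauchy-Schwarz bounds the accumulated current, which grows exactly linearly in time, by
  a linear function involving v. Comparing slopes at large times gives the claim.\<close>

lemma velocity_ge:
  fixes p :: "nat ^ 'd" and v B :: real
  assumes p: "\<And>i. 1 \<le> p $ i" "periodic p V"
    and LR: "\<And>n m t. 0 \<le> t \<Longrightarrow>
      cmod (ell2_apply (G t m) n) \<le> K * exp (- \<rho> * (real_of_int (l1_norm (n - m)) - v * t))"
    and pos: "0 < K" "0 < \<rho>" "0 < v"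
    and B: "\<And>\<psi>. norm (H \<psi>) \<le> B * norm \<psi>" "0 \<le> B"
  shows "1 \<le> 2 * v * B ^ (p $ i - 1)"
proof -
  let ?W = "fundamental_cell p" and ?b = "B ^ (p $ i - 1)"
  have "\<exists>c. \<forall>m. 0 \<le> c m \<and> (\<forall>t\<ge>0. norm (displacement i t m) \<le> 2 * v * t + c m)"
    using norm_displacement_le[OF LR pos] by (intro choice) blast
  then obtain c where c: "\<And>m. 0 \<le> c m" "\<And>m t. 0 \<le> t \<Longrightarrow> norm (displacement i t m) \<le> 2 * v * t + c m"
    by blast
  have W: "0 < card ?W"
    using cell_rep_in_cell[OF p(1)] finite_fundamental_cell[of p] by (auto simp: card_gt_0_iff)
  have le: "card ?W * t \<le> ?b * (card ?W * (2 * v * t) + (\<Sum>m\<in>?W. c m))" if t: "0 \<le> t" for t :: real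
  proof -
    have "card ?W * t = (\<Sum>m\<in>?W. inner ((H ^^ (p $ i - 1)) (G t (m + axis i (int (p $ i))))) (\<i> *\<^sub>C displacement i t m))"
      by (rule accumulated_current[OF p, symmetric])
    also have "\<dots> \<le> (\<Sum>m\<in>?W. ?b * (2 * v * t + c m))"
    proof (rule sum_mono)
      fix m
      have "inner ((H ^^ (p $ i - 1)) (G t (m + axis i (int (p $ i))))) (\<i> *\<^sub>C displacement i t m)
          \<le> norm ((H ^^ (p $ i - 1)) (G t (m + axis i (int (p $ i))))) * norm (\<i> *\<^sub>C displacement i t m)"
        by (rule norm_cauchy_schwarz)
      also have "\<dots> \<le> ?b * (2 * v * t + c m)"
        using norm_funpow_le[OF B, where k = "p $ i - 1" and \<psi> = "G t (m + axis i (int (p $ i)))"] c(2)[OF t, of m] B(2)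
        by (intro mult_mono) (simp_all add: norm_unitary_group norm_scaleC_ell2)
      finally show "inner ((H ^^ (p $ i - 1)) (G t (m + axis i (int (p $ i))))) (\<i> *\<^sub>C displacement i t m)
          \<le> ?b * (2 * v * t + c m)" .
    qed
    finally show ?thesis by (simp add: sum_distrib_left[symmetric] sum.distrib)
  qed
  show ?thesis
  proof (rule ccontr)
    assume "\<not> 1 \<le> 2 * v * ?b"
    define d where "d = card ?W * (1 - 2 * v * ?b)"
    have d: "0 < d" using W \<open>\<not> 1 \<le> 2 * v * ?b\<close> by (simp add: d_def)
    define c' where "c' = ?b * (\<Sum>m\<in>?W. c m)"
    have "0 \<le> c'" using B c(1) by (simp add: c'_def sum_nonneg)
    have "d * t \<le> c'" if "0 \<le> t" for t
      using le[OF that] by (simp add: d_def c'_def algebra_simps)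
    \<comment> \<open>At this time the left-hand side equals c' + 1.\<close>
    from this[of "(c' + 1) / d"] show False using d \<open>0 \<le> c'\<close> by simp
  qed
qed

end

proposition velocity_optimality:
  fixes p :: "nat ^ 'd" and V :: "int ^ 'd \<Rightarrow> real"
  assumes p: "\<And>i. 1 \<le> p $ i" and per: "periodic p V"
  shows "\<exists>c > 0. \<forall>K \<rho> v\<^sub>L\<^sub>R :: real \<Rightarrow> real.
    (\<forall>\<^sub>F \<mu> in at_top. K \<mu> > 0 \<and> \<rho> \<mu> > 0 \<and> v\<^sub>L\<^sub>R \<mu> > 0 \<and>
      (\<forall>n m. \<forall>t \<ge> 0.
        cmod (cinner_ell2 (delta n) (unitary_group (schroedinger_op \<mu> V) t (delta m)))
          \<le> K \<mu> * exp (- \<rho> \<mu> * (real_of_int (l1_norm (n - m)) - v\<^sub>L\<^sub>R \<mu> * \<bar>t\<bar>))))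
    \<longrightarrow> (\<forall>\<^sub>F \<mu> in at_top. v\<^sub>L\<^sub>R \<mu> \<ge> c * \<mu> powi (- int (min_period p) + 1))"
proof -
  have bV: "bounded (range V)" by (rule bounded_periodic[OF p per])
  then obtain B where B: "\<And>n. \<bar>V n\<bar> \<le> B" by (auto simp: bounded_iff)
  have B0: "0 \<le> B" using B[of 0] by linarith
  define P where "P = min_period p"
  have "P \<in> range (\<lambda>i. p $ i)" unfolding P_def min_period_def by (rule Min_in) auto
  then obtain i where i: "p $ i = P" by auto
  have P: "0 < P" unfolding P_def by (rule min_period_pos[OF p])
  \<comment> \<open>For \<mu> \<ge> 1 the hopping part is also at most \<mu> times its own bound, so
    the norm of H is at most \<open>\<mu> * b\<close>. The added 1 ensures positivity.\<close>
  define b where "b = real (card {e :: int ^ 'd. l1_norm e = 1}) + B + 1"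
  have b: "0 < b" using B0 by (simp add: b_def add_nonneg_pos)
  \<comment> \<open>Obtained by solving \<open>1 \<le> 2 * v \<mu> * (\<mu> * b) ^ (P - 1)\<close>
    for the velocity, in a direction i of smallest period.\<close>
  define c where "c = 1 / (2 * b ^ (P - 1))"
  show ?thesis
  proof (intro exI[of _ c] conjI allI impI)
    show "0 < c" using b by (simp add: c_def)
    fix K \<rho> v :: "real \<Rightarrow> real"
    assume LR: "\<forall>\<^sub>F \<mu> in at_top. K \<mu> > 0 \<and> \<rho> \<mu> > 0 \<and> v \<mu> > 0 \<and>
      (\<forall>n m. \<forall>t \<ge> 0.
        cmod (cinner_ell2 (delta n) (unitary_group (schroedinger_op \<mu> V) t (delta m)))
          \<le> K \<mu> * exp (- \<rho> \<mu> * (real_of_int (l1_norm (n - m)) - v \<mu> * \<bar>t\<bar>)))"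
    show "\<forall>\<^sub>F \<mu> in at_top. v \<mu> \<ge> c * \<mu> powi (- int (min_period p) + 1)"
      using LR eventually_ge_at_top[of 1]
    proof eventually_elim
      case (elim \<mu>)
      have "norm (schroedinger_op \<mu> V \<psi>) \<le> \<mu> * b * norm \<psi>" for \<psi>
      proof -
        have "real (card {e :: int ^ 'd. l1_norm e = 1}) \<le> \<mu> * real (card {e :: int ^ 'd. l1_norm e = 1})"
          using mult_right_mono[OF elim(2), of "real (card {e :: int ^ 'd. l1_norm e = 1})"] by simp
        then have "real (card {e :: int ^ 'd. l1_norm e = 1}) + \<mu> * B \<le> \<mu> * b"
          using elim(2) by (simp add: b_def distrib_left)
        then have "(real (card {e :: int ^ 'd. l1_norm e = 1}) + \<mu> * B) * norm \<psi> \<le> \<mu> * b * norm \<psi>"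
          by (rule mult_right_mono) simp
        then show ?thesis using norm_schroedinger_le[OF bV B, where \<mu> = \<mu> and \<psi> = \<psi>] elim(2) by linarith
      qed
      then have "1 \<le> 2 * v \<mu> * (\<mu> * b) ^ (p $ i - 1)"
        using elim b by (intro velocity_ge[OF bV p per, of \<mu> "K \<mu>" "\<rho> \<mu>"]) (auto simp: cinner_delta)
      then show ?case
        unfolding P_def[symmetric] powi_one_minus[OF P] c_def i
        using elim(2) b by (simp add: power_mult_distrib field_simps)
    qed
  qed
qed

theorem theorem2p2:
  fixes p :: "nat ^ 'd"
  assumes "\<forall>i. 1 \<le> p $ i"
  shows
    "(\<forall>\<rho>\<^sub>0 > 0. \<forall>s. \<exists>C C\<^sub>1 \<mu>\<^sub>0. C > 0 \<and> C\<^sub>1 > 0 \<and> \<mu>\<^sub>0 > 0 \<and>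
        (\<forall>V. periodic p V \<and> nondegenerate p V \<and> separation p V = s \<longrightarrow>
          (\<forall>n m. \<forall>\<mu> \<ge> \<mu>\<^sub>0. \<forall>t \<ge> 0.
            cmod (cinner_ell2 (delta n) (unitary_group (schroedinger_op \<mu> V) t (delta m)))
              \<le> C * exp (- \<rho>\<^sub>0 * (real_of_int (l1_norm (n - m))
                              - C\<^sub>1 * \<mu> powi (- int (min_period p) + 1) * \<bar>t\<bar>)))))
     \<and>
     (\<forall>V. periodic p V \<and> nondegenerate p V \<longrightarrow>
        (\<exists>c > 0. \<forall>K \<rho> v\<^sub>L\<^sub>R :: real \<Rightarrow> real.
          (\<forall>\<^sub>F \<mu> in at_top. K \<mu> > 0 \<and> \<rho> \<mu> > 0 \<and> v\<^sub>L\<^sub>R \<mu> > 0 \<and>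
            (\<forall>n m. \<forall>t \<ge> 0.
              cmod (cinner_ell2 (delta n) (unitary_group (schroedinger_op \<mu> V) t (delta m)))
                \<le> K \<mu> * exp (- \<rho> \<mu> * (real_of_int (l1_norm (n - m)) - v\<^sub>L\<^sub>R \<mu> * \<bar>t\<bar>))))
          \<longrightarrow> (\<forall>\<^sub>F \<mu> in at_top. v\<^sub>L\<^sub>R \<mu> \<ge> c * \<mu> powi (- int (min_period p) + 1))))"
  using assms by (intro conjI allI impI velocity_upper_bound velocity_optimality) auto

end
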